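(* Let $\mathcal{C}_x$ be the class of all XOS functions $\{0,1\}^n\to[0,1]$. There exists an algorithm that learns $\mathcal{C}_x$ agnostically with excess $\ell_2$-error $\epsilon$ over the uniform distribution and runs in time $n^{O(1/\epsilon)}$.
   Context: $f$ is XOS if $f(x)=\max_{c\in C}\sum_{i=1}^n w_{ci}x_i$ for a nonempty finite set $C$ and weights $w_{ci}\ge0$. For a distribution $\mathcal{P}$ on $\{0,1\}^n\times[0,1]$ and a class $\mathcal{F}$, $\mathrm{opt}(\mathcal{P},\mathcal{F})=\inf_{f\in\mathcal{F}}\sqrt{\mathbb{E}_{(x,\ell)\sim\mathcal{P}}[(\ell-f(x))^2]}$. An algorithm learns $\mathcal{F}$ agnostically with excess $\ell_2$-error over the uniform distribution if for every $\epsilon>0$ and every distribution $\mathcal{P}$ on $\{0,1\}^n\times[0,1]$ whose marginal on $\{0,1\}^n$ is uniform, given independent random examples from $\mathcal{P}$, with probability at least $2/3$ it outputs $h$ with $\sqrt{\mathbb{E}_{(x,\ell)\sim\mathcal{P}}[(h(x)-\ell)^2]}\le\mathrm{opt}(\mathcal{P},\mathcal{F})+\epsilon$. *)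

theory Defs
  imports "HOL-Probability.Probability"
begin

section \<open>XOS functions on the discrete cube\<close>

definition cube :: "nat \<Rightarrow> bool list set" where
  "cube n = {x. length x = n}"

text \<open>
  A real-valued function on the cube is a total function on \<^typ>\<open>bool list\<close> of which
  only the values on \<^term>\<open>cube n\<close> matter. Taking the finite index set inside \<^typ>\<open>nat\<close>
  loses no generality.
\<close>

definition xos :: "nat \<Rightarrow> (bool list \<Rightarrow> real) \<Rightarrow> bool" where
  "xos n f \<longleftrightarrow> (\<exists>(C :: nat set) (w :: nat \<Rightarrow> nat \<Rightarrow> real).
     finite C \<and> C \<noteq> {} \<and> (\<forall>c\<in>C. \<forall>i<n. 0 \<le> w c i) \<and>
     (\<forall>x\<in>cube n. f x = Max ((\<lambda>c. \<Sum>i<n. w c i * of_bool (x ! i)) ` C)))"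

definition xos_class :: "nat \<Rightarrow> (bool list \<Rightarrow> real) set" where
  "xos_class n = {f. xos n f \<and> (\<forall>x\<in>cube n. f x \<in> {0..1})}"


section \<open>Distributions on labelled examples and the l2-error\<close>

definition example_space :: "nat \<Rightarrow> (bool list \<times> real) measure" where
  "example_space n = count_space (cube n) \<Otimes>\<^sub>M restrict_space borel {0..1}"

definition uniform_marginal_dists :: "nat \<Rightarrow> (bool list \<times> real) measure set" where
  "uniform_marginal_dists n = {P. prob_space P \<and> sets P = sets (example_space n) \<and>
     distr P (count_space (cube n)) fst = uniform_count_measure (cube n)}"

definition l2_error :: "(bool list \<times> real) measure \<Rightarrow> (bool list \<Rightarrow> real) \<Rightarrow> real" where
  "l2_error P h = sqrt (\<integral>(x, l). (h x - l)\<^sup>2 \<partial>P)"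

definition opt :: "(bool list \<times> real) measure \<Rightarrow> (bool list \<Rightarrow> real) set \<Rightarrow> real" where
  "opt P F = (INF f\<in>F. l2_error P f)"


section \<open>Programs\<close>

text \<open>
  Algorithms are while-programs of a real RAM. There are two unbounded memories, one of
  natural numbers and one of exact real numbers, both addressed by natural numbers
  (indirect addressing is nesting of \<open>NMem\<close>). Naturals have addition and truncated
  subtraction only; reals have the four field operations and exact comparison. There
  is a cast from naturals to reals but none (in particular no floor) in the other
  direction, and the only constants are natural numbers, so that programs carry no
  real-valued advice.

  Besides the memories, a program sees a current point of the cube, which it can only read bit
  by bit, and a current label. \<open>Draw\<close> replaces these by the next example of the sample.
\<close>

datatype nexp =
    NConst nat
  | NMem nexp
  | NBit nexp
  | NAdd nexp nexp
  | NSub nexp nexp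

datatype rexp =
    RNat nexp
  | RMem nexp
  | RLabel
  | RAdd rexp rexp
  | RSub rexp rexp
  | RMul rexp rexp
  | RDiv rexp rexp

datatype bexp =
    NLe nexp nexp
  | RLe rexp rexp
  | BNot bexp
  | BAnd bexp bexp

datatype com =
    Skip
  | NStore nexp nexp
  | RStore nexp rexp
  | Draw
  | Seq com com
  | If bexp com com
  | While bexp com

record state =
  nmem :: "nat \<Rightarrow> nat"
  rmem :: "nat \<Rightarrow> real"
  point :: "bool list"
  label :: real
  sample :: "nat \<Rightarrow> bool list \<times> real"

fun nval :: "nexp \<Rightarrow> state \<Rightarrow> nat" where
  "nval (NConst k) s = k"
| "nval (NMem a) s = nmem s (nval a s)"
| "nval (NBit a) s = of_bool (nval a s < length (point s) \<and> point s ! nval a s)"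
| "nval (NAdd a b) s = nval a s + nval b s"
| "nval (NSub a b) s = nval a s - nval b s"

fun rval :: "rexp \<Rightarrow> state \<Rightarrow> real" where
  "rval (RNat a) s = real (nval a s)"
| "rval (RMem a) s = rmem s (nval a s)"
| "rval RLabel s = label s"
| "rval (RAdd a b) s = rval a s + rval b s"
| "rval (RSub a b) s = rval a s - rval b s"
| "rval (RMul a b) s = rval a s * rval b s"
| "rval (RDiv a b) s = rval a s / rval b s"

fun bval :: "bexp \<Rightarrow> state \<Rightarrow> bool" where
  "bval (NLe a b) s \<longleftrightarrow> nval a s \<le> nval b s"
| "bval (RLe a b) s \<longleftrightarrow> rval a s \<le> rval b s"
| "bval (BNot b) s \<longleftrightarrow> \<not> bval b s"
| "bval (BAnd a b) s \<longleftrightarrow> bval a s \<and> bval b s"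

text \<open>
  \<open>exec c s t s'\<close>: started in \<open>s\<close>, the program \<open>c\<close> halts in \<open>s'\<close> after \<open>t\<close> steps. One step is one
  elementary command or one test; as expressions are part of the fixed program text, counting
  individual arithmetic operations would change \<open>t\<close> by at most a constant factor depending on \<open>c\<close>.
\<close>

inductive exec :: "com \<Rightarrow> state \<Rightarrow> nat \<Rightarrow> state \<Rightarrow> bool" where
  Skip: "exec Skip s 1 s"
| NStore: "exec (NStore a e) s 1 (s\<lparr>nmem := (nmem s)(nval a s := nval e s)\<rparr>)"
| RStore: "exec (RStore a e) s 1 (s\<lparr>rmem := (rmem s)(nval a s := rval e s)\<rparr>)"
| Draw: "exec Draw s 1
    (s\<lparr>point := fst (sample s 0), label := snd (sample s 0), sample := (\<lambda>i. sample s (Suc i))\<rparr>)"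
| Seq: "exec c1 s t1 s1 \<Longrightarrow> exec c2 s1 t2 s2 \<Longrightarrow> exec (Seq c1 c2) s (t1 + t2) s2"
| IfTrue: "bval b s \<Longrightarrow> exec c1 s t s' \<Longrightarrow> exec (If b c1 c2) s (Suc t) s'"
| IfFalse: "\<not> bval b s \<Longrightarrow> exec c2 s t s' \<Longrightarrow> exec (If b c1 c2) s (Suc t) s'"
| WhileFalse: "\<not> bval b s \<Longrightarrow> exec (While b c) s 1 s"
| WhileTrue: "bval b s \<Longrightarrow> exec c s t1 s1 \<Longrightarrow> exec (While b c) s1 t2 s2 \<Longrightarrow>
    exec (While b c) s (Suc (t1 + t2)) s2"

inductive_cases exec_elims:
  "exec Skip s t s'" "exec (NStore a e) s t s'" "exec (RStore a d) s t s'" "exec Draw s t s'"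
inductive_cases exec_SeqE: "exec (Seq c1 c2) s t s'"
inductive_cases exec_IfE: "exec (If b c1 c2) s t s'"
inductive_cases exec_WhileE: "exec (While b c) s t s'"

lemma exec_deterministic:
  "exec c s t s' \<Longrightarrow> exec c s u s'' \<Longrightarrow> u = t \<and> s'' = s'"
proof (induction arbitrary: u s'' rule: exec.induct)
  case (Seq c1 s t1 s1 c2 t2 s2)
  from Seq.prems obtain v1 r v2 where "u = v1 + v2" "exec c1 s v1 r" "exec c2 r v2 s''"
    by (rule exec_SeqE)
  with Seq.IH(1)[of v1 r] Seq.IH(2)[of v2 s''] show ?case by simp
next
  case (IfTrue b s c1 t s' c2)
  from IfTrue.prems IfTrue.hyps(1) obtain v where "u = Suc v" "exec c1 s v s''"
    by (auto elim!: exec_IfE)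
  with IfTrue.IH[of v s''] show ?case by simp
next
  case (IfFalse b s c2 t s' c1)
  from IfFalse.prems IfFalse.hyps(1) obtain v where "u = Suc v" "exec c2 s v s''"
    by (auto elim!: exec_IfE)
  with IfFalse.IH[of v s''] show ?case by simp
next
  case (WhileFalse b s c)
  from WhileFalse.prems WhileFalse.hyps show ?case by (auto elim!: exec_WhileE)
next
  case (WhileTrue b s c t1 s1 t2 s2)
  from WhileTrue.prems obtain v1 r v2
    where "u = Suc (v1 + v2)" "exec c s v1 r" "exec (While b c) r v2 s''"
    by (rule exec_WhileE) (use WhileTrue.hyps(1) in auto)
  with WhileTrue.IH(1)[of v1 r] WhileTrue.IH(2)[of v2 s''] show ?case by simp
qed (erule exec_elims, simp)+

definition final :: "com \<Rightarrow> state \<Rightarrow> state" where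
  "final c s = (THE s'. \<exists>t. exec c s t s')"

lemma final_eq: "exec c s t s' \<Longrightarrow> final c s = s'"
  unfolding final_def using exec_deterministic by blast


section \<open>Learning algorithms\<close>

text \<open>
  A learning algorithm is a training program together with a prediction program. Training
  starts with \<open>n\<close> and \<open>\<epsilon>\<close> in the first natural and real memory cell. The output hypothesis
  is represented by the memory contents left by training: its value at \<open>x\<close> is what the
  prediction program, given these contents and \<open>x\<close> (but no further examples), leaves in the
  first real cell.
\<close>

datatype learner = Learner (train: com) (predict: com)

definition train_state :: "nat \<Rightarrow> real \<Rightarrow> (nat \<Rightarrow> bool list \<times> real) \<Rightarrow> state" where
  "train_state n \<epsilon> \<omega> = \<lparr>nmem = (\<lambda>_. 0)(0 := n), rmem = (\<lambda>_. 0)(0 := \<epsilon>),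
     point = [], label = 0, sample = \<omega>\<rparr>"

definition predict_state :: "state \<Rightarrow> bool list \<Rightarrow> state" where
  "predict_state s x = \<lparr>nmem = nmem s, rmem = rmem s,
     point = x, label = 0, sample = (\<lambda>_. ([], 0))\<rparr>"

definition hypothesis ::
    "learner \<Rightarrow> nat \<Rightarrow> real \<Rightarrow> (nat \<Rightarrow> bool list \<times> real) \<Rightarrow> bool list \<Rightarrow> real" where
  "hypothesis A n \<epsilon> \<omega> x =
     rmem (final (predict A) (predict_state (final (train A) (train_state n \<epsilon> \<omega>)) x)) 0"

text \<open>
  Worst-case running time: for every sequence of examples, training halts within \<open>T\<close> steps, and
  so does every evaluation of the hypothesis it outputs.
\<close>

definition runs_in_time :: "learner \<Rightarrow> nat \<Rightarrow> real \<Rightarrow> real \<Rightarrow> bool" where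
  "runs_in_time A n \<epsilon> T \<longleftrightarrow>
     (\<forall>\<omega>. (\<forall>i. \<omega> i \<in> space (example_space n)) \<longrightarrow>
       (\<exists>t s. exec (train A) (train_state n \<epsilon> \<omega>) t s \<and> real t \<le> T \<and>
         (\<forall>x\<in>cube n. \<exists>t' s'. exec (predict A) (predict_state s x) t' s' \<and> real t' \<le> T)))"

text \<open>
  The infinite product measure models an unlimited supply of independent examples, of which
  a halting run reads finitely many.
\<close>

definition agnostically_learns :: "learner \<Rightarrow> (nat \<Rightarrow> (bool list \<Rightarrow> real) set) \<Rightarrow> bool" where
  "agnostically_learns A F \<longleftrightarrow>
     (\<forall>n\<ge>1. \<forall>\<epsilon>>0. \<forall>P\<in>uniform_marginal_dists n.
       measure (\<Pi>\<^sub>M i\<in>(UNIV :: nat set). P)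
         {\<omega> \<in> space (\<Pi>\<^sub>M i\<in>(UNIV :: nat set). P).
            l2_error P (hypothesis A n \<epsilon> \<omega>) \<le> opt P (F n) + \<epsilon>} \<ge> 2 / 3)"

text \<open>
  Time \<open>n\<^bsup>O(1/\<epsilon>)\<^esup>\<close>. The base is at least 2 because for \<open>n = 1\<close> a literal power of \<open>n\<close> would
  not depend on \<open>\<epsilon>\<close>; the factor \<open>a\<close> can be absorbed into \<open>b\<close> when \<open>\<epsilon> \<le> 1\<close> and prevents the
  bound from dropping to a single step as \<open>\<epsilon>\<close> tends to infinity.
\<close>

definition time_n_pow_O_inverse_eps :: "learner \<Rightarrow> bool" where
  "time_n_pow_O_inverse_eps A \<longleftrightarrow>
     (\<exists>a b :: real. \<forall>n\<ge>1. \<forall>\<epsilon>>0.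
        runs_in_time A n \<epsilon> (a * real (max 2 n) powr (b / \<epsilon>)))"

end

theory Submission
  imports Defs
begin

text \<open>
  Let \<open>L\<close> be the Laplacian of the cube. An XOS function \<open>f\<close> with values in \<open>[0, 1]\<close> satisfies
  \<open>E (L f)\<^sup>2 \<le> E f\<^sup>2 \<le> 1\<close>. Indeed \<open>L f = (D - U) / 2\<close>, where \<open>D x\<close> is the total loss of \<open>f\<close> when single
  elements are removed from \<open>x\<close> and \<open>U x\<close> is the total gain when single elements are added.
  Clearly \<open>0 \<le> D \<le> f\<close>. If \<open>w z\<close> is the weight vector attaining \<open>f z\<close>, the gains of two elements \<open>i\<close>
  and \<open>j\<close> have product at most \<open>w z i * w (z - i) j + w z j * w (z - j) i\<close> with \<open>z = x + i + j\<close>; as \<open>x\<close> and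
  \<open>z\<close> are equidistributed, these terms sum to at most \<open>2 * E f\<^sup>2\<close>, and with the diagonal \<open>E U\<^sup>2 \<le> 3 * E f\<^sup>2\<close>.
  So the Walsh weight of \<open>f\<close> above degree \<open>d\<close> is at most \<open>1 / (d + 1)\<^sup>2\<close>, and degree \<open>O(1 / \<epsilon>)\<close> suffices.

  The learner estimates the low-degree Walsh coefficients of the label by empirical averages. It
  never writes them down: training only stores the examples, and prediction evaluates the
  low-degree kernel \<open>\<Sum>\<^sub>S walsh S y * walsh S x\<close> by dynamic programming.
  For \<open>\<epsilon> \<ge> 1\<close> the zero hypothesis is good enough.
\<close>

section \<open>Walsh expansion on the cube\<close>

definition sgn_bit :: "bool list \<Rightarrow> nat \<Rightarrow> real" where
  "sgn_bit x i = (if x ! i then -1 else 1)"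

definition walsh :: "nat set \<Rightarrow> bool list \<Rightarrow> real" where
  "walsh S x = (\<Prod>i\<in>S. sgn_bit x i)"

definition fourier :: "nat \<Rightarrow> (bool list \<Rightarrow> real) \<Rightarrow> nat set \<Rightarrow> real" where
  "fourier n f S = (\<Sum>x\<in>cube n. f x * walsh S x) / 2 ^ n"

definition flip :: "bool list \<Rightarrow> nat \<Rightarrow> bool list" where
  "flip x i = x[i := \<not> x ! i]"

lemma finite_cube [simp]: "finite (cube n)"
  and card_cube: "card (cube n) = 2 ^ n"
  using finite_lists_length_eq[of "UNIV :: bool set" n]
    card_lists_length_eq[of "UNIV :: bool set" n]
  by (simp_all add: cube_def)

lemma flip_in_cube [simp]: "x \<in> cube n \<Longrightarrow> flip x i \<in> cube n"
  by (simp add: cube_def flip_def)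

lemma length_cube [simp]: "x \<in> cube n \<Longrightarrow> length x = n"
  by (simp add: cube_def)

lemma length_flip [simp]: "length (flip x i) = length x"
  by (simp add: flip_def)

lemma flip_flip: "i < length x \<Longrightarrow> flip (flip x i) i = x"
  by (simp add: flip_def)

lemma sum_flip:
  assumes "i < n"
  shows "(\<Sum>x\<in>cube n. f (flip x i)) = (\<Sum>x\<in>cube n. f x)"
  by (rule sum.reindex_bij_witness[where i = "\<lambda>x. flip x i" and j = "\<lambda>x. flip x i"])
    (use assms in \<open>auto simp: flip_flip\<close>)

lemma sgn_bit_flip:
  assumes "i < length x"
  shows "sgn_bit (flip x i) j = (if j = i then - sgn_bit x j else sgn_bit x j)"
  using assms by (simp add: sgn_bit_def flip_def nth_list_update)

lemma sgn_bit_sq [simp]: "sgn_bit x i * sgn_bit x i = 1"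
  by (simp add: sgn_bit_def)

lemma walsh_flip:
  assumes "i < length x" "finite S"
  shows "walsh S (flip x i) = (if i \<in> S then - walsh S x else walsh S x)"
proof (cases "i \<in> S")
  case True
  then have "walsh S y = sgn_bit y i * (\<Prod>j\<in>S - {i}. sgn_bit y j)" for y
    unfolding walsh_def using assms(2) by (simp add: prod.remove)
  moreover have "(\<Prod>j\<in>S - {i}. sgn_bit (flip x i) j) = (\<Prod>j\<in>S - {i}. sgn_bit x j)"
    using assms(1) by (intro prod.cong) (auto simp: sgn_bit_flip)
  ultimately show ?thesis
    using True assms(1) by (simp add: sgn_bit_flip)
next
  case False
  then show ?thesis
    unfolding walsh_def using assms(1) by (auto simp: sgn_bit_flip intro!: prod.cong)
qed

lemma walsh_sq [simp]: "walsh S x * walsh S x = 1"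
  unfolding walsh_def by (simp flip: prod.distrib)

section \<open>Orthogonality, inversion and Parseval\<close>

lemma walsh_orthogonal:
  assumes "S \<subseteq> {..<n}" "T \<subseteq> {..<n}"
  shows "(\<Sum>x\<in>cube n. walsh S x * walsh T x) = (if S = T then 2 ^ n else 0)"
proof (cases "S = T")
  case True
  then show ?thesis by (simp add: card_cube)
next
  case False
  then obtain i where i: "i \<in> S \<longleftrightarrow> i \<notin> T" by blast
  then have "i < n" using assms by auto
  have fin: "finite S" "finite T" using assms finite_subset by blast+
  \<comment> \<open>Flipping a coordinate that lies in exactly one of \<open>S\<close> and
    \<open>T\<close> permutes the cube and negates the product, so the sum equals its own
    negative.\<close>
  have "(\<Sum>x\<in>cube n. walsh S x * walsh T x) = (\<Sum>x\<in>cube n. walsh S (flip x i) * walsh T (flip x i))"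
    by (rule sum_flip[OF \<open>i < n\<close>, symmetric])
  also have "\<dots> = (\<Sum>x\<in>cube n. - (walsh S x * walsh T x))"
    using i fin \<open>i < n\<close> by (intro sum.cong) (auto simp: walsh_flip)
  finally show ?thesis using False by (simp add: sum_negf)
qed

text \<open>The sum over all subsets factors into a product over coordinates; a coordinate where
  \<open>x\<close> and \<open>y\<close> differ contributes the factor 0.\<close>

lemma walsh_complete:
  assumes "x \<in> cube n" "y \<in> cube n"
  shows "(\<Sum>S\<in>Pow {..<n}. walsh S x * walsh S y) = (if x = y then 2 ^ n else 0)"
proof -
  have "(\<Sum>S\<in>Pow {..<n}. walsh S x * walsh S y) = (\<Prod>i<n. sgn_bit x i * sgn_bit y i + 1)"
    unfolding prod_add[OF finite_lessThan] by (simp add: walsh_def prod.distrib)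
  also have "\<dots> = (if x = y then 2 ^ n else 0)"
  proof (cases "x = y")
    case False
    have len: "length x = n" "length y = n" using assms by simp_all
    have "\<exists>i<n. (x ! i) \<noteq> (y ! i)"
      using False len by (simp add: list_eq_iff_nth_eq)
    then obtain i where i: "i < n" "x ! i \<noteq> y ! i" by blast
    then have "sgn_bit x i * sgn_bit y i + 1 = 0"
      by (cases "x ! i"; cases "y ! i") (simp_all add: sgn_bit_def)
    then have "\<exists>i\<in>{..<n}. sgn_bit x i * sgn_bit y i + 1 = 0"
      using i by blast
    then have "(\<Prod>i<n. sgn_bit x i * sgn_bit y i + 1) = 0"
      by (intro prod_zero finite_lessThan)
    then show ?thesis using False by simp
  qed simp
  finally show ?thesis .
qed

lemma fourier_inversion:
  assumes "x \<in> cube n"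
  shows "(\<Sum>S\<in>Pow {..<n}. fourier n f S * walsh S x) = f x"
proof -
  have "(\<Sum>S\<in>Pow {..<n}. fourier n f S * walsh S x)
      = (\<Sum>S\<in>Pow {..<n}. \<Sum>y\<in>cube n. f y * (walsh S y * walsh S x) / 2 ^ n)"
    by (simp only: fourier_def sum_distrib_right sum_divide_distrib times_divide_eq_left mult.assoc)
  also have "\<dots> = (\<Sum>y\<in>cube n. \<Sum>S\<in>Pow {..<n}. f y * (walsh S y * walsh S x) / 2 ^ n)"
    by (rule sum.swap)
  also have "\<dots> = (\<Sum>y\<in>cube n. f y * (\<Sum>S\<in>Pow {..<n}. walsh S y * walsh S x)) / 2 ^ n"
    by (simp only: sum_distrib_left sum_divide_distrib)
  also have "\<dots> = (\<Sum>y\<in>cube n. if y = x then f y * 2 ^ n else 0) / 2 ^ n"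
    using assms by (intro arg_cong2[where f = "(/)"] sum.cong) (auto simp: walsh_complete)
  also have "\<dots> = f x"
    using assms by (simp add: sum.delta)
  finally show ?thesis .
qed

text \<open>Orthogonality removes the off-diagonal terms of the expanded square. The coefficients
  are arbitrary because the identity is applied to tails, to the Laplacian and to estimated
  coefficients alike.\<close>

lemma walsh_parseval:
  assumes "A \<subseteq> Pow {..<n}"
  shows "(\<Sum>x\<in>cube n. (\<Sum>S\<in>A. c S * walsh S x)\<^sup>2) / 2 ^ n = (\<Sum>S\<in>A. (c S)\<^sup>2)"
proof -
  have "finite A" using assms finite_subset by blast
  have "(\<Sum>x\<in>cube n. (\<Sum>S\<in>A. c S * walsh S x)\<^sup>2)
      = (\<Sum>x\<in>cube n. \<Sum>S\<in>A. \<Sum>T\<in>A. c S * c T * (walsh S x * walsh T x))"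
    by (simp add: power2_eq_square sum_product ac_simps)
  also have "\<dots> = (\<Sum>S\<in>A. \<Sum>T\<in>A. c S * c T * (\<Sum>x\<in>cube n. walsh S x * walsh T x))"
    unfolding sum_distrib_left by (subst sum.swap, intro sum.cong refl sum.swap)
  also have "\<dots> = (\<Sum>S\<in>A. \<Sum>T\<in>A. if S = T then c S * c T * 2 ^ n else 0)"
  proof (intro sum.cong refl)
    fix S T assume "S \<in> A" "T \<in> A"
    then have "S \<subseteq> {..<n}" "T \<subseteq> {..<n}" using assms by auto
    then show "c S * c T * (\<Sum>x\<in>cube n. walsh S x * walsh T x) = (if S = T then c S * c T * 2 ^ n else 0)"
      by (simp add: walsh_orthogonal)
  qed
  also have "\<dots> = (\<Sum>S\<in>A. (c S)\<^sup>2) * 2 ^ n"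
    using \<open>finite A\<close> by (simp add: sum.delta power2_eq_square sum_distrib_right)
  finally show ?thesis by simp
qed

section \<open>The Laplacian and its spectrum\<close>

definition laplacian :: "nat \<Rightarrow> (bool list \<Rightarrow> real) \<Rightarrow> bool list \<Rightarrow> real" where
  "laplacian n f x = (\<Sum>i<n. (f x - f (flip x i)) / 2)"

text \<open>A flip at \<open>i\<close> changes \<open>walsh S\<close> only for \<open>i\<close> in
  \<open>S\<close>, where half the difference is the value itself. The factor 1/2 in
  \<open>laplacian\<close> thus makes the eigenvalue equal to the degree.\<close>

lemma laplacian_walsh:
  assumes "S \<subseteq> {..<n}" "x \<in> cube n"
  shows "laplacian n (walsh S) x = real (card S) * walsh S x"
proof -
  have fin: "finite S" using assms(1) finite_subset by blast
  have "laplacian n (walsh S) x = (\<Sum>i<n. if i \<in> S then walsh S x else 0)"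
    unfolding laplacian_def using assms(2) fin by (intro sum.cong) (auto simp: walsh_flip)
  also have "\<dots> = (\<Sum>i\<in>{..<n} \<inter> S. walsh S x)"
    by (rule sum.inter_restrict[symmetric]) simp
  also have "{..<n} \<inter> S = S" using assms(1) by blast
  finally show ?thesis by simp
qed

lemma laplacian_expansion:
  assumes "x \<in> cube n"
  shows "laplacian n f x = (\<Sum>S\<in>Pow {..<n}. real (card S) * fourier n f S * walsh S x)"
proof -
  have "laplacian n f x = (\<Sum>i<n. \<Sum>S\<in>Pow {..<n}. fourier n f S * ((walsh S x - walsh S (flip x i)) / 2))"
    unfolding laplacian_def
  proof (intro sum.cong refl)
    fix i
    have "(f x - f (flip x i)) / 2
        = ((\<Sum>S\<in>Pow {..<n}. fourier n f S * walsh S x) - (\<Sum>S\<in>Pow {..<n}. fourier n f S * walsh S (flip x i))) / 2"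
      using assms by (simp only: fourier_inversion flip_in_cube)
    also have "\<dots> = (\<Sum>S\<in>Pow {..<n}. fourier n f S * ((walsh S x - walsh S (flip x i)) / 2))"
      by (simp only: sum_subtractf[symmetric] sum_divide_distrib right_diff_distrib[symmetric] times_divide_eq_right)
    finally show "(f x - f (flip x i)) / 2 = \<dots>" .
  qed
  also have "\<dots> = (\<Sum>S\<in>Pow {..<n}. fourier n f S * laplacian n (walsh S) x)"
    unfolding laplacian_def sum_distrib_left by (rule sum.swap)
  also have "\<dots> = (\<Sum>S\<in>Pow {..<n}. real (card S) * fourier n f S * walsh S x)"
    using assms by (intro sum.cong) (auto simp: laplacian_walsh)
  finally show ?thesis .
qed

lemma laplacian_parseval:
  "(\<Sum>x\<in>cube n. (laplacian n f x)\<^sup>2) / 2 ^ n = (\<Sum>S\<in>Pow {..<n}. (real (card S) * fourier n f S)\<^sup>2)"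
proof -
  have "(\<Sum>x\<in>cube n. (laplacian n f x)\<^sup>2)
      = (\<Sum>x\<in>cube n. (\<Sum>S\<in>Pow {..<n}. (real (card S) * fourier n f S) * walsh S x)\<^sup>2)"
    by (intro sum.cong refl) (simp only: laplacian_expansion)
  then show ?thesis
    by (simp only: walsh_parseval[OF order_refl])
qed

text \<open>\<open>W x\<close> acts like a subgradient: exact at \<open>x\<close> and a lower bound
  elsewhere. The Laplacian bound uses nothing else about the maximum, so the index set
  \<open>C\<close> disappears from here on.\<close>

definition supports :: "nat \<Rightarrow> (bool list \<Rightarrow> nat \<Rightarrow> real) \<Rightarrow> (bool list \<Rightarrow> real) \<Rightarrow> bool" where
  "supports n W f \<longleftrightarrow> (\<forall>x\<in>cube n. (\<forall>i<n. 0 \<le> W x i) \<and> f x = (\<Sum>i<n. W x i * of_bool (x ! i)) \<and>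
     (\<forall>y\<in>cube n. (\<Sum>i<n. W x i * of_bool (y ! i)) \<le> f y))"

lemma xos_supports:
  assumes "xos n f"
  obtains W where "supports n W f"
proof -
  from assms obtain C :: "nat set" and w where C: "finite C" "C \<noteq> {}" "\<forall>c\<in>C. \<forall>i<n. 0 \<le> w c i"
    and f: "\<forall>x\<in>cube n. f x = Max ((\<lambda>c. \<Sum>i<n. w c i * of_bool (x ! i)) ` C)"
    unfolding xos_def by (elim exE conjE)
  have "\<exists>c\<in>C. f x = (\<Sum>i<n. w c i * of_bool (x ! i))" if "x \<in> cube n" for x
  proof -
    have "f x \<in> (\<lambda>c. \<Sum>i<n. w c i * of_bool (x ! i)) ` C"
      unfolding f[rule_format, OF that] using C by (intro Max_in) auto
    then show ?thesis by blast
  qed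
  then obtain g where g: "g x \<in> C" "f x = (\<Sum>i<n. w (g x) i * of_bool (x ! i))" if "x \<in> cube n" for x
    by metis
  have "(\<Sum>i<n. w c i * of_bool (y ! i)) \<le> f y" if "c \<in> C" "y \<in> cube n" for c y
  proof -
    have "(\<Sum>i<n. w c i * of_bool (y ! i)) \<le> Max ((\<lambda>c. \<Sum>i<n. w c i * of_bool (y ! i)) ` C)"
      using that C by (intro Max_ge) auto
    then show ?thesis using f that by simp
  qed
  then have "supports n (\<lambda>x. w (g x)) f"
    unfolding supports_def using g C(3) by meson
  then show ?thesis by (rule that)
qed

section \<open>The Laplacian of an XOS function\<close>

lemma flip_nth: "i < length x \<Longrightarrow> flip x i ! j = (if j = i then \<not> x ! i else x ! j)"
  by (simp add: flip_def)

lemma flip_commute: "i \<noteq> j \<Longrightarrow> flip (flip x i) j = flip (flip x j) i"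
  by (simp add: flip_def list_update_swap)

lemma sum_flip2:
  assumes "i < n" "j < n"
  shows "(\<Sum>x\<in>cube n. F (flip (flip x i) j)) = (\<Sum>x\<in>cube n. F x)"
  using sum_flip[OF assms(1), of "\<lambda>x. F (flip x j)"] sum_flip[OF assms(2), of F] by simp

lemma sum_weights_flip:
  assumes "x \<in> cube n" "i < n" "x ! i"
  shows "(\<Sum>k<n. w k * of_bool (flip x i ! k)) = (\<Sum>k<n. w k * of_bool (x ! k)) - (w i :: real)"
proof -
  have "(\<Sum>k<n. w k * of_bool (flip x i ! k))
      = (\<Sum>k<n. w k * of_bool (x ! k) - (if k = i then w i else 0))"
    using assms by (intro sum.cong) (auto simp: flip_nth)
  then show ?thesis
    using assms(2) by (simp add: sum_subtractf)
qed

context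
  fixes n :: nat and W :: "bool list \<Rightarrow> nat \<Rightarrow> real" and f :: "bool list \<Rightarrow> real"
  assumes supp: "supports n W f"
begin

lemma weight_nonneg: "x \<in> cube n \<Longrightarrow> i < n \<Longrightarrow> 0 \<le> W x i"
  and value_eq: "x \<in> cube n \<Longrightarrow> (\<Sum>i<n. W x i * of_bool (x ! i)) = f x"
  and weight_below: "x \<in> cube n \<Longrightarrow> y \<in> cube n \<Longrightarrow> (\<Sum>i<n. W x i * of_bool (y ! i)) \<le> f y"
  using supp unfolding supports_def by metis+

text \<open>The weight vector of \<open>x\<close> remains a lower bound for \<open>f\<close> after
  the removal, where its own value has dropped by just \<open>W x i\<close>.\<close>

lemma removal_loss:
  assumes "x \<in> cube n" "i < n" "x ! i"
  shows "f x - f (flip x i) \<le> W x i"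
  using weight_below[OF assms(1) flip_in_cube[OF assms(1)], of i] sum_weights_flip[OF assms, of "W x"]
    value_eq[OF assms(1)] by linarith

text \<open>Both weights come from the same vector \<open>W x\<close>. Two applications of
  \<open>removal_loss\<close> would instead bound the second loss by a weight of
  \<open>W (flip x i)\<close>.\<close>

lemma removal_loss2:
  assumes "x \<in> cube n" "i < n" "j < n" "i \<noteq> j" "x ! i" "x ! j"
  shows "f x - f (flip (flip x i) j) \<le> W x i + W x j"
proof -
  have "flip x i ! j" using assms by (simp add: flip_nth)
  then show ?thesis
    using weight_below[OF assms(1) flip_in_cube[OF flip_in_cube[OF assms(1)]], of i j]
      sum_weights_flip[of x n i "W x"] sum_weights_flip[of "flip x i" n j "W x"]
      value_eq[OF assms(1)] assms flip_in_cube[OF assms(1), of i] by linarith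
qed

text \<open>Monotonicity: the nonnegative weights of \<open>x\<close> can only collect more at the
  larger point.\<close>

lemma insertion_gain:
  assumes "x \<in> cube n" "i < n" "\<not> x ! i"
  shows "f x \<le> f (flip x i)"
proof -
  have "f x = (\<Sum>k<n. W x k * of_bool (x ! k))"
    using assms by (simp only: value_eq)
  also have "\<dots> \<le> (\<Sum>k<n. W x k * of_bool (flip x i ! k))"
    using assms weight_nonneg[OF assms(1)] by (intro sum_mono mult_left_mono) (auto simp: flip_nth)
  also have "\<dots> \<le> f (flip x i)"
    using assms(1) by (intro weight_below) simp_all
  finally show ?thesis .
qed

lemma insertion_gain_le:
  assumes "x \<in> cube n" "i < n" "\<not> x ! i"
  shows "f (flip x i) - f x \<le> W (flip x i) i"
  using removal_loss[of "flip x i" i] assms by (simp add: flip_nth flip_flip)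

lemma removal_loss_nonneg:
  assumes "x \<in> cube n" "i < n" "x ! i"
  shows "f (flip x i) \<le> f x"
  using insertion_gain[of "flip x i" i] assms by (simp add: flip_nth flip_flip)

section \<open>Gains and losses of single elements\<close>

definition gain :: "bool list \<Rightarrow> nat \<Rightarrow> real" where
  "gain x i = of_bool (\<not> x ! i) * (f (flip x i) - f x)"

definition loss :: "bool list \<Rightarrow> nat \<Rightarrow> real" where
  "loss x i = of_bool (x ! i) * (f x - f (flip x i))"

lemma gain_nonneg: "x \<in> cube n \<Longrightarrow> i < n \<Longrightarrow> 0 \<le> gain x i"
  using insertion_gain by (simp add: gain_def)

lemma loss_nonneg: "x \<in> cube n \<Longrightarrow> i < n \<Longrightarrow> 0 \<le> loss x i"
  using removal_loss_nonneg by (simp add: loss_def)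

text \<open>The indicators in \<open>gain\<close> and \<open>loss\<close> assign each coordinate to
  exactly one of the two sums; an insertion enters the Laplacian with a minus sign.\<close>

lemma laplacian_gain_loss: "laplacian n f x = ((\<Sum>i<n. loss x i) - (\<Sum>i<n. gain x i)) / 2"
  unfolding laplacian_def sum_subtractf[symmetric] sum_divide_distrib
  by (intro sum.cong) (auto simp: gain_def loss_def)

text \<open>Each loss is at most the weight of the removed element, and the weights of the elements
  present add up to \<open>f x\<close>.\<close>

lemma sum_loss_le:
  assumes "x \<in> cube n"
  shows "(\<Sum>i<n. loss x i) \<le> f x"
proof -
  have "(\<Sum>i<n. loss x i) \<le> (\<Sum>i<n. W x i * of_bool (x ! i))"
    using assms removal_loss by (intro sum_mono) (simp add: loss_def)
  then show ?thesis using assms by (simp only: value_eq)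
qed

text \<open>The second weight is taken from the vector supporting \<open>f\<close> after
  \<open>i\<close> has been removed, so the expression is not symmetric in \<open>i\<close> and
  \<open>j\<close>.\<close>

definition pair_weight :: "bool list \<Rightarrow> nat \<Rightarrow> nat \<Rightarrow> real" where
  "pair_weight x i j = of_bool (x ! i \<and> x ! j) * (W x i * W (flip x i) j)"

lemma pair_weight_nonneg:
  "x \<in> cube n \<Longrightarrow> i < n \<Longrightarrow> j < n \<Longrightarrow> 0 \<le> pair_weight x i j"
  by (simp add: pair_weight_def weight_nonneg)

text \<open>
  The gains of i and j are both at most the gain of adding i and j together, which is at most
  the sum of the weights of i and j at the upper point; so the product of the gains is at most
  that sum times the smaller gain.
\<close>

lemma gain_mult_le:
  assumes x: "x \<in> cube n" and ij: "i < n" "j < n" "i \<noteq> j"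
  shows "gain x i * gain x j
    \<le> pair_weight (flip (flip x i) j) i j + pair_weight (flip (flip x i) j) j i"
proof (cases "x ! i \<or> x ! j")
  case True
  then have "gain x i * gain x j = 0" by (auto simp: gain_def)
  also have "0 \<le> pair_weight (flip (flip x i) j) i j + pair_weight (flip (flip x i) j) j i"
    using x ij by (intro add_nonneg_nonneg pair_weight_nonneg) simp_all
  finally show ?thesis .
next
  case False
  define z where "z = flip (flip x i) j"
  have z: "z \<in> cube n" using x by (simp add: z_def)
  have zi: "flip z i = flip x j" and zj: "flip z j = flip x i" and zij: "flip (flip z i) j = x"
    using x ij by (simp_all add: z_def flip_flip flip_commute[of i j])
  have bits: "z ! i" "z ! j" "\<not> flip x i ! j" "\<not> flip x j ! i"
    using x ij False by (simp_all add: z_def flip_nth)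
  have up: "f (flip x i) \<le> f z" "f (flip x j) \<le> f z"
    using removal_loss_nonneg[OF z] bits ij zi zj by metis+
  have total: "f z - f x \<le> W z i + W z j"
    using removal_loss2[OF z] ij bits zij by metis
  have gi: "gain x i = f (flip x i) - f x" and gj: "gain x j = f (flip x j) - f x"
    using False by (simp_all add: gain_def)
  have gw: "gain x i \<le> W (flip x i) i" "gain x j \<le> W (flip x j) j"
    unfolding gi gj using insertion_gain_le x ij False by auto
  have nn: "0 \<le> gain x i" "0 \<le> gain x j" "0 \<le> W z i" "0 \<le> W z j"
    using x z ij by (simp_all add: gain_nonneg weight_nonneg)
  have "gain x i * gain x j = max (gain x i) (gain x j) * min (gain x i) (gain x j)"
    by (simp add: max_def min_def)
  also have "\<dots> \<le> (W z i + W z j) * min (gain x i) (gain x j)"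
    using nn up total unfolding gi gj by (intro mult_right_mono) auto
  \<comment> \<open>The minimum is replaced crosswise: the gain of \<open>j\<close> at
    \<open>x\<close> has \<open>flip x j = flip z i\<close> as its upper point, so next to the
    weight of \<open>i\<close> it fits \<open>pair_weight z i j\<close>.\<close>
  also have "\<dots> \<le> W z i * gain x j + W z j * gain x i"
    unfolding distrib_right using nn by (intro add_mono mult_left_mono) auto
  also have "\<dots> \<le> W z i * W (flip x j) j + W z j * W (flip x i) i"
    using nn gw by (intro add_mono mult_left_mono) auto
  also have "\<dots> = pair_weight z i j + pair_weight z j i"
    using bits by (simp add: pair_weight_def zi zj)
  finally show ?thesis by (simp add: z_def)
qed

text \<open>Summing over \<open>j\<close> first collects the weights supporting \<open>f\<close> at
  \<open>flip x i\<close>, which give at most \<open>f (flip x i)\<close> and hence at most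
  \<open>f x\<close>. The weights of \<open>i\<close> then give \<open>f x\<close> once
  more.\<close>

lemma sum_pair_weight_le:
  assumes "x \<in> cube n"
  shows "(\<Sum>i<n. \<Sum>j\<in>{..<n} - {i}. pair_weight x i j) \<le> (f x)\<^sup>2"
proof -
  have "(\<Sum>j\<in>{..<n} - {i}. pair_weight x i j) \<le> W x i * of_bool (x ! i) * f x" if i: "i < n" for i
  proof (cases "x ! i")
    case True
    have "(\<Sum>j\<in>{..<n} - {i}. pair_weight x i j)
        \<le> (\<Sum>j\<in>{..<n} - {i}. W x i * (W (flip x i) j * of_bool (flip x i ! j)))"
      using assms i True by (intro sum_mono) (auto simp: pair_weight_def flip_nth)
    also have "\<dots> \<le> (\<Sum>j<n. W x i * (W (flip x i) j * of_bool (flip x i ! j)))"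
      using assms i by (intro sum_mono2) (auto simp: weight_nonneg)
    also have "\<dots> = W x i * f (flip x i)"
      using assms by (simp only: sum_distrib_left[symmetric] value_eq flip_in_cube)
    also have "\<dots> \<le> W x i * f x"
      using assms i True removal_loss_nonneg by (intro mult_left_mono) (auto simp: weight_nonneg)
    finally show ?thesis using True by simp
  qed (simp add: pair_weight_def)
  then have "(\<Sum>i<n. \<Sum>j\<in>{..<n} - {i}. pair_weight x i j)
      \<le> (\<Sum>i<n. W x i * of_bool (x ! i) * f x)"
    by (intro sum_mono) simp
  also have "\<dots> = (f x)\<^sup>2"
    unfolding sum_distrib_right[symmetric] value_eq[OF assms] by (simp add: power2_eq_square)
  finally show ?thesis .
qed

text \<open>The gain of \<open>i\<close> at \<open>x\<close> is bounded by a weight at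
  \<open>flip x i\<close>. Summing over the cube allows the base point to be moved there, and
  squares of nonnegative numbers sum to at most the square of their sum.\<close>

lemma sum_gain_diagonal_le: "(\<Sum>x\<in>cube n. \<Sum>i<n. (gain x i)\<^sup>2) \<le> (\<Sum>x\<in>cube n. (f x)\<^sup>2)"
proof -
  have "(\<Sum>x\<in>cube n. \<Sum>i<n. (gain x i)\<^sup>2) \<le> (\<Sum>x\<in>cube n. \<Sum>i<n. (W (flip x i) i * of_bool (flip x i ! i))\<^sup>2)"
    using insertion_gain insertion_gain_le
    by (intro sum_mono) (auto simp: gain_def flip_nth intro!: power_mono)
  also have "\<dots> = (\<Sum>i<n. \<Sum>x\<in>cube n. (W (flip x i) i * of_bool (flip x i ! i))\<^sup>2)"
    by (rule sum.swap)
  also have "\<dots> = (\<Sum>i<n. \<Sum>x\<in>cube n. (W x i * of_bool (x ! i))\<^sup>2)"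
    by (intro sum.cong refl sum_flip) simp
  also have "\<dots> = (\<Sum>x\<in>cube n. \<Sum>i<n. (W x i * of_bool (x ! i))\<^sup>2)"
    by (rule sum.swap)
  also have "\<dots> \<le> (\<Sum>x\<in>cube n. (\<Sum>i<n. W x i * of_bool (x ! i))\<^sup>2)"
  proof (intro sum_mono)
    fix x assume x: "x \<in> cube n"
    have nn: "0 \<le> W x i * of_bool (x ! i)" if "i < n" for i
      using x that by (simp add: weight_nonneg)
    have "(\<Sum>i<n. (W x i * of_bool (x ! i))\<^sup>2) \<le> (\<Sum>i<n. (W x i * of_bool (x ! i)) * (\<Sum>k<n. W x k * of_bool (x ! k)))"
      unfolding power2_eq_square using nn
      by (intro sum_mono mult_left_mono member_le_sum) auto
    also have "\<dots> = (\<Sum>i<n. W x i * of_bool (x ! i))\<^sup>2"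
      by (simp only: sum_distrib_right[symmetric] power2_eq_square)
    finally show "(\<Sum>i<n. (W x i * of_bool (x ! i))\<^sup>2) \<le> (\<Sum>i<n. W x i * of_bool (x ! i))\<^sup>2" .
  qed
  also have "\<dots> = (\<Sum>x\<in>cube n. (f x)\<^sup>2)"
    by (intro sum.cong refl) (simp only: value_eq)
  finally show ?thesis .
qed

text \<open>For fixed \<open>i\<close> and \<open>j\<close> the doubly flipped point runs through
  the whole cube as \<open>x\<close> does, so the pair weights may be summed at \<open>x\<close>
  itself. The two orders of \<open>i\<close> and \<open>j\<close> contribute equally, whence the
  factor 2.\<close>

lemma sum_gain_off_diagonal_le:
  "(\<Sum>x\<in>cube n. \<Sum>i<n. \<Sum>j\<in>{..<n} - {i}. gain x i * gain x j) \<le> 2 * (\<Sum>x\<in>cube n. (f x)\<^sup>2)"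
proof -
  have swap: "(\<Sum>x\<in>cube n. \<Sum>i<n. \<Sum>j\<in>{..<n} - {i}. F x i j)
      = (\<Sum>i<n. \<Sum>j\<in>{..<n} - {i}. \<Sum>x\<in>cube n. F x i j)" for F :: "bool list \<Rightarrow> nat \<Rightarrow> nat \<Rightarrow> real"
    by (subst sum.swap) (intro sum.cong refl sum.swap)
  have sym: "(\<Sum>i<n. \<Sum>j\<in>{..<n} - {i}. F j i) = (\<Sum>i<n. \<Sum>j\<in>{..<n} - {i}. F i j)"
    for F :: "nat \<Rightarrow> nat \<Rightarrow> real"
  proof -
    have "(\<Sum>i<n. \<Sum>j\<in>{j\<in>{..<n}. i \<noteq> j}. F j i) = (\<Sum>j<n. \<Sum>i\<in>{i\<in>{..<n}. i \<noteq> j}. F j i)"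
      by (rule sum.swap_restrict) simp_all
    moreover have "{j\<in>{..<n}. i \<noteq> j} = {..<n} - {i}" "{j\<in>{..<n}. j \<noteq> i} = {..<n} - {i}" for i
      by auto
    ultimately show ?thesis by simp
  qed
  have "(\<Sum>x\<in>cube n. \<Sum>i<n. \<Sum>j\<in>{..<n} - {i}. gain x i * gain x j)
      \<le> (\<Sum>x\<in>cube n. \<Sum>i<n. \<Sum>j\<in>{..<n} - {i}.
          pair_weight (flip (flip x i) j) i j + pair_weight (flip (flip x i) j) j i)"
    by (intro sum_mono gain_mult_le) auto
  also have "\<dots> = (\<Sum>i<n. \<Sum>j\<in>{..<n} - {i}. \<Sum>x\<in>cube n. pair_weight x i j + pair_weight x j i)"
    unfolding swap by (intro sum.cong refl sum_flip2) auto
  also have "\<dots> = 2 * (\<Sum>i<n. \<Sum>j\<in>{..<n} - {i}. \<Sum>x\<in>cube n. pair_weight x i j)"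
    unfolding sum.distrib using sym[of "\<lambda>i j. \<Sum>x\<in>cube n. pair_weight x i j"] by simp
  also have "\<dots> \<le> 2 * (\<Sum>x\<in>cube n. (f x)\<^sup>2)"
    unfolding swap[symmetric] by (intro mult_left_mono sum_mono sum_pair_weight_le) auto
  finally show ?thesis .
qed

lemma sum_gain_sq_le: "(\<Sum>x\<in>cube n. (\<Sum>i<n. gain x i)\<^sup>2) \<le> 3 * (\<Sum>x\<in>cube n. (f x)\<^sup>2)"
proof -
  have "(\<Sum>i<n. gain x i)\<^sup>2 = (\<Sum>i<n. (gain x i)\<^sup>2) + (\<Sum>i<n. \<Sum>j\<in>{..<n} - {i}. gain x i * gain x j)" for x
  proof -
    have "(\<Sum>i<n. gain x i)\<^sup>2 = (\<Sum>i<n. \<Sum>j<n. gain x i * gain x j)"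
      by (simp only: power2_eq_square sum_product)
    also have "\<dots> = (\<Sum>i<n. (gain x i)\<^sup>2 + (\<Sum>j\<in>{..<n} - {i}. gain x i * gain x j))"
      by (intro sum.cong refl) (simp add: sum.remove power2_eq_square)
    finally show ?thesis by (simp only: sum.distrib)
  qed
  then show ?thesis
    using sum_gain_diagonal_le sum_gain_off_diagonal_le by (simp add: sum.distrib)
qed

text \<open>In the expanded square of \<open>D - U\<close> the mixed term is at most 0, as both sums
  are nonnegative. There remains a quarter of the two squares, whose bounds 1 and 3 add up to
  4.\<close>

lemma laplacian_sq_le: "(\<Sum>x\<in>cube n. (laplacian n f x)\<^sup>2) \<le> (\<Sum>x\<in>cube n. (f x)\<^sup>2)"
proof -
  have "(laplacian n f x)\<^sup>2 \<le> ((f x)\<^sup>2 + (\<Sum>i<n. gain x i)\<^sup>2) / 4" if x: "x \<in> cube n" for x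
  proof -
    define D U where "D = (\<Sum>i<n. loss x i)" and "U = (\<Sum>i<n. gain x i)"
    have "0 \<le> D" "0 \<le> U"
      unfolding D_def U_def using x by (auto intro!: sum_nonneg loss_nonneg gain_nonneg)
    moreover have "D\<^sup>2 \<le> (f x)\<^sup>2"
      using sum_loss_le[OF x] \<open>0 \<le> D\<close> unfolding D_def by (intro power_mono)
    moreover have "(laplacian n f x)\<^sup>2 = (D\<^sup>2 - 2 * (D * U) + U\<^sup>2) / 4"
      unfolding laplacian_gain_loss D_def[symmetric] U_def[symmetric]
      by (simp add: power_divide power2_diff)
    moreover have "0 \<le> D * U" using \<open>0 \<le> D\<close> \<open>0 \<le> U\<close> by simp
    ultimately show ?thesis unfolding U_def[symmetric] by argo
  qed
  then have "(\<Sum>x\<in>cube n. (laplacian n f x)\<^sup>2)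
      \<le> ((\<Sum>x\<in>cube n. (f x)\<^sup>2) + (\<Sum>x\<in>cube n. (\<Sum>i<n. gain x i)\<^sup>2)) / 4"
    unfolding sum.distrib[symmetric] sum_divide_distrib by (rule sum_mono)
  then show ?thesis using sum_gain_sq_le by simp
qed

end

section \<open>Low-degree truncation\<close>

definition low_degree :: "nat \<Rightarrow> nat \<Rightarrow> nat set set" where
  "low_degree n d = {S. S \<subseteq> {..<n} \<and> card S \<le> d}"

lemma finite_low_degree [simp]: "finite (low_degree n d)"
  by (rule finite_subset[of _ "Pow {..<n}"]) (auto simp: low_degree_def)

definition truncate :: "nat \<Rightarrow> nat \<Rightarrow> (bool list \<Rightarrow> real) \<Rightarrow> bool list \<Rightarrow> real" where
  "truncate n d f x = (\<Sum>S\<in>low_degree n d. fourier n f S * walsh S x)"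

text \<open>The discarded sets have at least \<open>d + 1\<close> elements, so their squared
  coefficients are at most those of the Laplacian divided by
  \<open>(real d + 1)\<^sup>2\<close>.\<close>

lemma truncation_error:
  "(\<Sum>x\<in>cube n. (f x - truncate n d f x)\<^sup>2) / 2 ^ n
    \<le> (\<Sum>x\<in>cube n. (laplacian n f x)\<^sup>2) / 2 ^ n / (real d + 1)\<^sup>2"
proof -
  have sub: "low_degree n d \<subseteq> Pow {..<n}" by (auto simp: low_degree_def)
  let ?H = "Pow {..<n} - low_degree n d"
  have "(\<Sum>x\<in>cube n. (f x - truncate n d f x)\<^sup>2)
      = (\<Sum>x\<in>cube n. (\<Sum>S\<in>?H. fourier n f S * walsh S x)\<^sup>2)"
    by (intro sum.cong refl) (simp add: sum_diff sub fourier_inversion truncate_def)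
  then have "(\<Sum>x\<in>cube n. (f x - truncate n d f x)\<^sup>2) / 2 ^ n = (\<Sum>S\<in>?H. (fourier n f S)\<^sup>2)"
    by (simp add: walsh_parseval)
  also have "\<dots> \<le> (\<Sum>S\<in>?H. (real (card S) * fourier n f S)\<^sup>2 / (real d + 1)\<^sup>2)"
  proof (intro sum_mono)
    fix S assume "S \<in> ?H"
    then have "real d + 1 \<le> real (card S)" by (auto simp: low_degree_def)
    then have "(real d + 1)\<^sup>2 \<le> (real (card S))\<^sup>2" by (intro power_mono) auto
    then have "(real d + 1)\<^sup>2 * (fourier n f S)\<^sup>2 \<le> (real (card S))\<^sup>2 * (fourier n f S)\<^sup>2"
      by (intro mult_right_mono) auto
    then show "(fourier n f S)\<^sup>2 \<le> (real (card S) * fourier n f S)\<^sup>2 / (real d + 1)\<^sup>2"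
      by (simp add: power_mult_distrib pos_le_divide_eq add_pos_nonneg mult.commute)
  qed
  also have "\<dots> \<le> (\<Sum>S\<in>Pow {..<n}. (real (card S) * fourier n f S)\<^sup>2) / (real d + 1)\<^sup>2"
    unfolding sum_divide_distrib[symmetric] by (intro divide_right_mono sum_mono2) auto
  finally show ?thesis by (simp add: laplacian_parseval)
qed

lemma xos_truncation_error:
  assumes "f \<in> xos_class n"
  shows "(\<Sum>x\<in>cube n. (f x - truncate n d f x)\<^sup>2) / 2 ^ n \<le> 1 / (real d + 1)\<^sup>2"
proof -
  obtain W where W: "supports n W f"
    using assms xos_supports by (auto simp: xos_class_def)
  have "(\<Sum>x\<in>cube n. (f x)\<^sup>2) \<le> (\<Sum>x\<in>cube n. 1)"
    using assms by (intro sum_mono power_le_one) (auto simp: xos_class_def)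
  then have "(\<Sum>x\<in>cube n. (laplacian n f x)\<^sup>2) / 2 ^ n \<le> 1"
    using laplacian_sq_le[OF W] by (simp add: card_cube)
  then have "(\<Sum>x\<in>cube n. (laplacian n f x)\<^sup>2) / 2 ^ n / (real d + 1)\<^sup>2 \<le> 1 / (real d + 1)\<^sup>2"
    by (intro divide_right_mono) auto
  then show ?thesis using truncation_error order_trans by blast
qed

section \<open>Empirical Walsh coefficients\<close>

text \<open>Minkowski's inequality in L2. It comes from Cauchy-Schwarz, and that from the
  nonnegativity of the quadratic \<open>a - 2 * t * c + t\<^sup>2 * b\<close> in
  \<open>t\<close>.\<close>

lemma sqrt_integral_add_sq_le:
  fixes u v :: "'a \<Rightarrow> real"
  assumes u: "integrable M (\<lambda>x. (u x)\<^sup>2)" and v: "integrable M (\<lambda>x. (v x)\<^sup>2)"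
    and uv: "integrable M (\<lambda>x. u x * v x)"
  shows "sqrt (\<integral>x. (u x + v x)\<^sup>2 \<partial>M) \<le> sqrt (\<integral>x. (u x)\<^sup>2 \<partial>M) + sqrt (\<integral>x. (v x)\<^sup>2 \<partial>M)"
proof -
  define a b c where "a = (\<integral>x. (u x)\<^sup>2 \<partial>M)" and "b = (\<integral>x. (v x)\<^sup>2 \<partial>M)" and "c = (\<integral>x. u x * v x \<partial>M)"
  have nn: "0 \<le> a" "0 \<le> b" by (simp_all add: a_def b_def)
  have quad: "0 \<le> a - 2 * t * c + t\<^sup>2 * b" for t
  proof -
    have "0 \<le> (\<integral>x. (u x - t * v x)\<^sup>2 \<partial>M)" by simp
    also have "\<dots> = (\<integral>x. (u x)\<^sup>2 - 2 * t * (u x * v x) + t\<^sup>2 * (v x)\<^sup>2 \<partial>M)"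
      by (intro Bochner_Integration.integral_cong refl) (simp add: power2_eq_square algebra_simps)
    also have "\<dots> = a - 2 * t * c + t\<^sup>2 * b"
      using u v uv by (simp add: a_def b_def c_def)
    finally show ?thesis .
  qed
  have "c\<^sup>2 \<le> a * b"
  proof (cases "b = 0")
    case True
    have "c = 0"
    proof (rule ccontr)
      assume "c \<noteq> 0"
      \<comment> \<open>With \<open>b = 0\<close> the quadratic is affine in \<open>t\<close>; this
        choice of \<open>t\<close> gives it the value -1.\<close>
      then show False using quad[of "(a + 1) / (2 * c)"] True nn by simp
    qed
    then show ?thesis using True by simp
  next
    case False
    \<comment> \<open>The quadratic is smallest at \<open>t = c / b\<close>.\<close>
    then show ?thesis
      using quad[of "c / b"] nn by (simp add: power2_eq_square field_simps)
  qed
  then have "c \<le> sqrt a * sqrt b"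
    unfolding real_sqrt_mult[symmetric] by (rule real_le_rsqrt)
  moreover have "(\<integral>x. (u x + v x)\<^sup>2 \<partial>M) = a + 2 * c + b"
  proof -
    have "(\<integral>x. (u x + v x)\<^sup>2 \<partial>M) = (\<integral>x. (u x)\<^sup>2 + 2 * (u x * v x) + (v x)\<^sup>2 \<partial>M)"
      by (intro Bochner_Integration.integral_cong refl) (simp add: power2_eq_square algebra_simps)
    then show ?thesis using u v uv by (simp add: a_def b_def c_def)
  qed
  ultimately show ?thesis
    unfolding a_def[symmetric] b_def[symmetric] using nn
    by (intro real_le_lsqrt) (auto simp: power2_sum)
qed

section \<open>Second moments of independent samples\<close>

context prob_space
begin

lemma iid_measurable:
  assumes "Y \<in> measurable M N"
  shows "(\<lambda>\<omega>. Y (\<omega> i)) \<in> measurable (\<Pi>\<^sub>M j\<in>(UNIV :: nat set). M) N"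
  using measurable_compose[OF measurable_component_singleton[of i UNIV "\<lambda>_. M"] assms] by simp

lemma integral_iid_coordinate:
  assumes [measurable]: "Y \<in> borel_measurable M"
  shows "(\<integral>\<omega>. Y (\<omega> i) \<partial>(\<Pi>\<^sub>M j\<in>(UNIV :: nat set). M)) = (\<integral>z. Y z \<partial>M :: real)"
proof -
  have "(\<integral>z. Y z \<partial>M) = (\<integral>z. Y z \<partial>distr (\<Pi>\<^sub>M j\<in>(UNIV :: nat set). M) M (\<lambda>\<omega>. \<omega> i))"
    by (subst distr_PiM_component) (auto intro: prob_space_axioms)
  then show ?thesis by (subst (asm) integral_distr) auto
qed

lemma integral_iid_mult:
  fixes Y :: "'a \<Rightarrow> real"
  assumes [measurable]: "Y \<in> borel_measurable M" and "integrable M Y" and "i \<noteq> j"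
  shows "(\<integral>\<omega>. Y (\<omega> i) * Y (\<omega> j) \<partial>(\<Pi>\<^sub>M k\<in>(UNIV :: nat set). M)) = (\<integral>z. Y z \<partial>M) * (\<integral>z. Y z \<partial>M)"
proof -
  let ?P = "\<Pi>\<^sub>M k\<in>(UNIV :: nat set). M"
  interpret P: prob_space ?P by (intro prob_space_PiM prob_space_axioms)
  have [measurable]: "(\<lambda>\<omega>. Y (\<omega> k)) \<in> borel_measurable ?P" for k
    by (rule iid_measurable) (rule assms(1))
  have "distr ?P M (\<lambda>\<omega>. \<omega> k) = M" for k
    by (rule distr_PiM_component) (auto intro: prob_space_axioms)
  \<comment> \<open>The joint map of all coordinates is the identity, so its distribution is the
    product of the coordinate distributions; this is independence.\<close>
  then have "P.indep_vars (\<lambda>_. M) (\<lambda>k \<omega>. \<omega> k) UNIV"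
    by (subst P.indep_vars_iff_distr_eq_PiM') (auto simp: restrict_UNIV)
  then have "P.indep_vars (\<lambda>_. borel) (\<lambda>k \<omega>. Y (\<omega> k)) UNIV"
    by (rule P.indep_vars_compose2) simp
  then have ind: "P.indep_vars (\<lambda>_. borel) (\<lambda>k \<omega>. Y (\<omega> k)) {i, j}"
    by (rule P.indep_vars_subset) simp
  have int: "integrable ?P (\<lambda>\<omega>. Y (\<omega> k))" for k
  proof -
    have "integrable (distr ?P M (\<lambda>\<omega>. \<omega> k)) Y"
      using assms(2) by (subst distr_PiM_component) (auto intro: prob_space_axioms)
    then show ?thesis by (subst (asm) integrable_distr_eq) auto
  qed
  have "(\<integral>\<omega>. (\<Prod>k\<in>{i, j}. Y (\<omega> k)) \<partial>?P) = (\<Prod>k\<in>{i, j}. \<integral>\<omega>. Y (\<omega> k) \<partial>?P)"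
    by (rule P.indep_vars_lebesgue_integral) (use ind int in auto)
  then show ?thesis using assms(3) by (simp add: integral_iid_coordinate)
qed

text \<open>Only the diagonal of the expanded square survives: distinct samples are independent, so
  their mixed moment is the square of the mean, which is 0. The bound \<open>B\<close> provides
  integrability.\<close>

lemma integral_iid_sum_sq:
  fixes Y :: "'a \<Rightarrow> real"
  assumes [measurable]: "Y \<in> borel_measurable M" and bound: "\<And>z. z \<in> space M \<Longrightarrow> \<bar>Y z\<bar> \<le> B"
    and centered: "(\<integral>z. Y z \<partial>M) = 0"
  shows "integrable (\<Pi>\<^sub>M j\<in>(UNIV :: nat set). M) (\<lambda>\<omega>. (\<Sum>j<m. Y (\<omega> j))\<^sup>2)" (is ?int)
    and "(\<integral>\<omega>. (\<Sum>j<m. Y (\<omega> j))\<^sup>2 \<partial>(\<Pi>\<^sub>M j\<in>(UNIV :: nat set). M)) = real m * (\<integral>z. (Y z)\<^sup>2 \<partial>M)" (is ?eq)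
proof -
  let ?P = "\<Pi>\<^sub>M k\<in>(UNIV :: nat set). M"
  interpret P: prob_space ?P by (intro prob_space_PiM prob_space_axioms)
  have [measurable]: "(\<lambda>\<omega>. Y (\<omega> k)) \<in> borel_measurable ?P" for k
    by (rule iid_measurable) (rule assms(1))
  have mem: "\<omega> j \<in> space M" if "\<omega> \<in> space ?P" for \<omega> j
    using that by (auto simp: space_PiM)
  have "integrable M Y"
    by (rule integrable_const_bound[where B = B]) (auto simp: bound)
  have int: "integrable ?P (\<lambda>\<omega>. Y (\<omega> i) * Y (\<omega> j))" for i j
  proof (rule P.integrable_const_bound[where B = "B * B"])
    show "AE \<omega> in ?P. norm (Y (\<omega> i) * Y (\<omega> j)) \<le> B * B"
    proof (rule AE_I2)
      fix \<omega> assume "\<omega> \<in> space ?P"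
      then have "\<bar>Y (\<omega> i)\<bar> \<le> B" "\<bar>Y (\<omega> j)\<bar> \<le> B" by (simp_all add: bound mem)
      then show "norm (Y (\<omega> i) * Y (\<omega> j)) \<le> B * B"
        by (simp add: abs_mult mult_mono)
    qed
  qed measurable
  have sq: "(\<Sum>j<m. Y (\<omega> j))\<^sup>2 = (\<Sum>i<m. \<Sum>j<m. Y (\<omega> i) * Y (\<omega> j))" for \<omega>
    by (simp only: power2_eq_square sum_product)
  show ?int
    unfolding sq by (intro Bochner_Integration.integrable_sum int)
  have "(\<integral>\<omega>. (\<Sum>j<m. Y (\<omega> j))\<^sup>2 \<partial>?P) = (\<Sum>i<m. \<Sum>j<m. \<integral>\<omega>. Y (\<omega> i) * Y (\<omega> j) \<partial>?P)"
    unfolding sq by (simp add: int)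
  also have "\<dots> = (\<Sum>i<m. \<Sum>j<m. if i = j then (\<integral>z. (Y z)\<^sup>2 \<partial>M) else 0)"
  proof (intro sum.cong refl)
    fix i j
    show "(\<integral>\<omega>. Y (\<omega> i) * Y (\<omega> j) \<partial>?P) = (if i = j then (\<integral>z. (Y z)\<^sup>2 \<partial>M) else 0)"
      using integral_iid_coordinate[of "\<lambda>z. Y z * Y z" i] integral_iid_mult[of Y i j] \<open>integrable M Y\<close>
      by (auto simp: centered power2_eq_square)
  qed
  finally show ?eq by simp
qed

end

section \<open>Distributions with uniform marginal\<close>

lemma uniform_marginal_distsD:
  assumes "P \<in> uniform_marginal_dists n"
  shows "prob_space P" "space P = cube n \<times> {0..1}"
    and "fst \<in> measurable P (count_space (cube n))" "snd \<in> borel_measurable P"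
    and "(\<integral>z. g (fst z) \<partial>P) = (\<Sum>x\<in>cube n. g x) / (2 ^ n :: real)"
proof -
  have P: "prob_space P" "sets P = sets (example_space n)"
    "distr P (count_space (cube n)) fst = uniform_count_measure (cube n)"
    using assms by (auto simp: uniform_marginal_dists_def)
  then show "prob_space P" by blast
  show "space P = cube n \<times> {0..1}"
    using sets_eq_imp_space_eq[OF P(2)] by (simp add: example_space_def space_pair_measure)
  show fst: "fst \<in> measurable P (count_space (cube n))"
    unfolding measurable_cong_sets[OF P(2) refl] example_space_def by (rule measurable_fst)
  have "snd \<in> measurable (example_space n) (restrict_space borel {0..1})"
    unfolding example_space_def by (rule measurable_snd)
  then show "snd \<in> borel_measurable P"
    unfolding measurable_cong_sets[OF P(2) refl] by (simp add: measurable_restrict_space2_iff)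
  have "(\<integral>z. g (fst z) \<partial>P) = (\<integral>x. g x \<partial>distr P (count_space (cube n)) fst)"
    by (rule integral_distr[OF fst, symmetric]) simp
  also have "\<dots> = (\<Sum>x\<in>cube n. g x) / (2 ^ n :: real)"
    unfolding P(3) by (simp add: integral_uniform_count_measure card_cube)
  finally show "(\<integral>z. g (fst z) \<partial>P) = (\<Sum>x\<in>cube n. g x) / (2 ^ n :: real)" .
qed

section \<open>Sums of products over small sets\<close>

fun low_degree_sum :: "(nat \<Rightarrow> real) \<Rightarrow> nat \<Rightarrow> nat \<Rightarrow> real" where
  "low_degree_sum s 0 k = 1"
| "low_degree_sum s (Suc i) 0 = 1"
| "low_degree_sum s (Suc i) (Suc k) = low_degree_sum s i (Suc k) + s i * low_degree_sum s i k"

lemma low_degree_0 [simp]: "low_degree 0 k = {{}}"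
  by (auto simp: low_degree_def)

lemma low_degree_k0 [simp]: "low_degree n 0 = {{}}"
  by (auto simp: low_degree_def finite_subset)

lemma low_degree_Suc:
  "low_degree (Suc n) (Suc k) = low_degree n (Suc k) \<union> insert n ` low_degree n k"
proof (intro equalityI subsetI)
  fix S assume S: "S \<in> low_degree (Suc n) (Suc k)"
  then have fin: "finite S" by (auto simp: low_degree_def intro: finite_subset)
  show "S \<in> low_degree n (Suc k) \<union> insert n ` low_degree n k"
  proof (cases "n \<in> S")
    case True
    then have "S = insert n (S - {n})" "S - {n} \<in> low_degree n k"
      using S fin by (auto simp: low_degree_def lessThan_Suc)
    then show ?thesis by blast
  qed (use S in \<open>auto simp: low_degree_def lessThan_Suc\<close>)
next
  fix S assume "S \<in> low_degree n (Suc k) \<union> insert n ` low_degree n k"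
  moreover have "card (insert n T) \<le> Suc k" if "T \<in> low_degree n k" for T
    using that card_insert_le_m1[of "Suc k" T n] by (auto simp: low_degree_def)
  ultimately show "S \<in> low_degree (Suc n) (Suc k)"
    by (auto simp: low_degree_def)
qed

text \<open>The recursion splits the sets by whether they contain the last index. With
  \<open>s i\<close> the product of the signs of two points at \<open>i\<close>, it computes the
  low-degree kernel without listing any sets.\<close>

lemma low_degree_sum_eq: "low_degree_sum s n k = (\<Sum>S\<in>low_degree n k. \<Prod>i\<in>S. s i)"
proof (induction s n k rule: low_degree_sum.induct)
  case (3 s n k)
  have notin: "n \<notin> S" "finite S" if "S \<in> low_degree n j" for S j
    using that by (auto simp: low_degree_def intro: finite_subset)
  have "(\<Sum>S\<in>low_degree (Suc n) (Suc k). \<Prod>i\<in>S. s i)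
      = (\<Sum>S\<in>low_degree n (Suc k). \<Prod>i\<in>S. s i) + (\<Sum>S\<in>insert n ` low_degree n k. \<Prod>i\<in>S. s i)"
    unfolding low_degree_Suc using notin by (intro sum.union_disjoint) auto
  also have "(\<Sum>S\<in>insert n ` low_degree n k. \<Prod>i\<in>S. s i) = (\<Sum>S\<in>low_degree n k. s n * (\<Prod>i\<in>S. s i))"
  proof (subst sum.reindex)
    show "inj_on (insert n) (low_degree n k)"
      using notin(1) by (intro inj_onI) (metis insert_ident)
  qed (use notin in \<open>auto intro!: sum.cong\<close>)
  finally show ?case by (simp add: 3 sum_distrib_left)
qed simp_all

text \<open>Counting is the case where all factors are 1, so the recursion of
  \<open>low_degree_sum\<close> serves as the induction scheme.\<close>

lemma card_low_degree_le: "real (card (low_degree n d)) \<le> (real n + 1) ^ d"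
proof -
  have "low_degree_sum (\<lambda>_. 1) n d \<le> (real n + 1) ^ d"
  proof (induction "\<lambda>_ :: nat. 1 :: real" n d rule: low_degree_sum.induct)
    case (3 n d)
    have "low_degree_sum (\<lambda>_. 1) (Suc n) (Suc d) \<le> (real n + 1) ^ Suc d + (real n + 1) ^ d"
      using 3 by simp
    also have "\<dots> = (real n + 2) * (real n + 1) ^ d" by (simp add: algebra_simps)
    also have "\<dots> \<le> (real n + 2) * (real n + 2) ^ d" by (intro mult_left_mono power_mono) auto
    finally show ?case by (simp add: add.commute)
  qed simp_all
  then show ?thesis by (simp add: low_degree_sum_eq)
qed

definition empirical :: "nat \<Rightarrow> (nat \<Rightarrow> bool list \<times> real) \<Rightarrow> nat set \<Rightarrow> real" where
  "empirical m \<omega> S = (\<Sum>j<m. snd (\<omega> j) * walsh S (fst (\<omega> j))) / m"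

section \<open>Least squares over low-degree Walsh combinations\<close>

locale labelled_cube =
  fixes n :: nat and P :: "(bool list \<times> real) measure"
  assumes P: "P \<in> uniform_marginal_dists n"
begin

sublocale prob_space P using P by (rule uniform_marginal_distsD)

lemma space_P: "space P = cube n \<times> {0..1}"
  using P by (rule uniform_marginal_distsD)

lemma measurable_fst_P [measurable]: "fst \<in> measurable P (count_space (cube n))"
  and measurable_snd_P [measurable]: "snd \<in> borel_measurable P"
  using P by (rule uniform_marginal_distsD)+

lemma measurable_point: "(\<lambda>z. g (fst z)) \<in> borel_measurable P" for g :: "bool list \<Rightarrow> real"
  using measurable_compose[OF measurable_fst_P, of g borel] by simp

text \<open>The bound \<open>h\<close> may depend on the point because the cube is finite, so a
  maximum over it is a constant bound.\<close>

lemma integrable_bounded: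
  fixes g :: "bool list \<times> real \<Rightarrow> real"
  assumes [measurable]: "g \<in> borel_measurable P" and "\<And>x l. x \<in> cube n \<Longrightarrow> 0 \<le> l \<Longrightarrow> l \<le> 1 \<Longrightarrow> \<bar>g (x, l)\<bar> \<le> h x"
  shows "integrable P g"
proof (rule integrable_const_bound[where B = "Max (insert 0 (h ` cube n))"])
  show "AE z in P. norm (g z) \<le> Max (insert 0 (h ` cube n))"
  proof (rule AE_I2)
    fix z assume "z \<in> space P"
    then obtain x l where z: "z = (x, l)" "x \<in> cube n" "0 \<le> l" "l \<le> 1"
      by (auto simp: space_P)
    then have "\<bar>g z\<bar> \<le> h x" by (simp add: assms(2))
    also have "\<dots> \<le> Max (insert 0 (h ` cube n))" using z by (intro Max_ge) auto
    finally show "norm (g z) \<le> Max (insert 0 (h ` cube n))" by simp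
  qed
qed simp

lemma integrable_point: "integrable P (\<lambda>z. g (fst z))" for g :: "bool list \<Rightarrow> real"
  using measurable_point[of g] by (rule integrable_bounded[where h = "\<lambda>x. \<bar>g x\<bar>"]) auto

lemma integrable_label_point: "integrable P (\<lambda>z. snd z * g (fst z))" for g :: "bool list \<Rightarrow> real"
proof (rule integrable_bounded[where h = "\<lambda>x. \<bar>g x\<bar>"])
  show "(\<lambda>z. snd z * g (fst z)) \<in> borel_measurable P"
    using measurable_point[of g] by measurable
qed (auto simp: abs_mult mult_left_le_one_le)

lemma integrable_label_sq: "integrable P (\<lambda>z. (snd z)\<^sup>2)"
  by (rule integrable_bounded[where h = "\<lambda>x. 1"]) (auto simp: abs_square_le_1)

lemma integral_point: "(\<integral>z. g (fst z) \<partial>P) = (\<Sum>x\<in>cube n. g x) / 2 ^ n" for g :: "bool list \<Rightarrow> real"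
  using P by (rule uniform_marginal_distsD)

text \<open>The Walsh coefficient at \<open>S\<close> of the regression function, that is the
  conditional mean of the label given the point, written without conditional expectations.\<close>

definition correlation :: "nat set \<Rightarrow> real" where
  "correlation S = (\<integral>z. snd z * walsh S (fst z) \<partial>P)"

text \<open>Completing the square: by orthogonality the coefficients enter only through their
  distance from \<open>correlation\<close>, which is therefore the least-squares choice.\<close>

lemma sq_error_expansion:
  assumes "A \<subseteq> Pow {..<n}"
  shows "(\<integral>z. (snd z - (\<Sum>S\<in>A. c S * walsh S (fst z)))\<^sup>2 \<partial>P)
    = (\<integral>z. (snd z)\<^sup>2 \<partial>P) - (\<Sum>S\<in>A. (correlation S)\<^sup>2) + (\<Sum>S\<in>A. (c S - correlation S)\<^sup>2)"
proof -
  have "(\<integral>z. (snd z - (\<Sum>S\<in>A. c S * walsh S (fst z)))\<^sup>2 \<partial>P)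
      = (\<integral>z. (snd z)\<^sup>2 - 2 * (\<Sum>S\<in>A. c S * (snd z * walsh S (fst z)))
          + (\<Sum>S\<in>A. c S * walsh S (fst z))\<^sup>2 \<partial>P)"
    by (intro Bochner_Integration.integral_cong refl) (simp add: power2_diff sum_distrib_left mult_ac)
  also have "\<dots> = (\<integral>z. (snd z)\<^sup>2 \<partial>P) - 2 * (\<Sum>S\<in>A. c S * correlation S) + (\<Sum>S\<in>A. (c S)\<^sup>2)"
  proof -
    have "integrable P (\<lambda>z. (\<Sum>S\<in>A. c S * walsh S (fst z))\<^sup>2)"
      by (rule integrable_point)
    then show ?thesis
      using walsh_parseval[OF assms, of c]
        integral_point[of "\<lambda>x. (\<Sum>S\<in>A. c S * walsh S x)\<^sup>2"]
      by (simp add: integrable_label_sq integrable_label_point correlation_def)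
  qed
  also have "\<dots> = (\<integral>z. (snd z)\<^sup>2 \<partial>P) - (\<Sum>S\<in>A. (correlation S)\<^sup>2) + (\<Sum>S\<in>A. (c S - correlation S)\<^sup>2)"
    by (simp add: power2_diff sum.distrib sum_subtractf sum_distrib_left mult_ac)
  finally show ?thesis .
qed

lemma l2_error_eq: "l2_error P h = sqrt (\<integral>z. (snd z - h (fst z))\<^sup>2 \<partial>P)"
proof -
  have "(\<lambda>(x, l). (h x - l)\<^sup>2) = (\<lambda>z. (snd z - h (fst z))\<^sup>2)"
    by (auto simp: power2_commute)
  then show ?thesis by (simp only: l2_error_def)
qed

lemma l2_error_cong:
  assumes "\<And>x. x \<in> cube n \<Longrightarrow> h x = h' x"
  shows "l2_error P h = l2_error P h'"
  unfolding l2_error_eq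
  by (intro arg_cong[where f = sqrt] Bochner_Integration.integral_cong refl) (auto simp: space_P assms)

text \<open>\<open>r\<close> is the least squared error of a combination of degree at most
  \<open>d\<close>, so \<open>sqrt r\<close> is at most the error of the truncation of
  \<open>f\<close>. One half of \<epsilon> pays for truncating \<open>f\<close>, the other half for
  the inexact coefficients \<open>c\<close>.\<close>

lemma l2_error_low_degree_le:
  assumes f: "f \<in> xos_class n" and d: "2 \<le> (real d + 1) * \<epsilon>" and \<epsilon>: "0 < \<epsilon>"
    and c: "(\<Sum>S\<in>low_degree n d. (c S - correlation S)\<^sup>2) \<le> (\<epsilon> / 2)\<^sup>2"
  shows "l2_error P (\<lambda>x. \<Sum>S\<in>low_degree n d. c S * walsh S x) \<le> l2_error P f + \<epsilon>"
proof -
  let ?A = "low_degree n d"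
  have sub: "?A \<subseteq> Pow {..<n}" by (auto simp: low_degree_def)
  define r where "r = (\<integral>z. (snd z)\<^sup>2 \<partial>P) - (\<Sum>S\<in>?A. (correlation S)\<^sup>2)"
  have expand: "(\<integral>z. (snd z - (\<Sum>S\<in>?A. c S * walsh S (fst z)))\<^sup>2 \<partial>P)
      = r + (\<Sum>S\<in>?A. (c S - correlation S)\<^sup>2)" for c
    unfolding r_def by (rule sq_error_expansion[OF sub])
  have "0 \<le> r"
    using expand[of correlation] Bochner_Integration.integral_nonneg[of P "\<lambda>z. (snd z - (\<Sum>S\<in>?A. correlation S * walsh S (fst z)))\<^sup>2"]
    by simp
  \<comment> \<open>The competitor is the truncation of \<open>f\<close>, whose coefficients are the
    Walsh coefficients of \<open>f\<close>.\<close>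
  have "r \<le> r + (\<Sum>S\<in>?A. (fourier n f S - correlation S)\<^sup>2)"
    by (simp add: sum_nonneg)
  also have "\<dots> = (\<integral>z. ((snd z - f (fst z)) + (f (fst z) - truncate n d f (fst z)))\<^sup>2 \<partial>P)"
    unfolding expand[symmetric] by (simp add: truncate_def)
  finally have "sqrt r \<le> sqrt (\<integral>z. ((snd z - f (fst z)) + (f (fst z) - truncate n d f (fst z)))\<^sup>2 \<partial>P)"
    by simp
  also have "\<dots> \<le> l2_error P f + sqrt (\<integral>z. (f (fst z) - truncate n d f (fst z))\<^sup>2 \<partial>P)"
    unfolding l2_error_eq
  proof (rule sqrt_integral_add_sq_le)
    show "integrable P (\<lambda>z. (snd z - f (fst z))\<^sup>2)"
    proof -
      have eq: "(snd z - f (fst z))\<^sup>2 = (snd z)\<^sup>2 - 2 * (snd z * f (fst z)) + (f (fst z))\<^sup>2"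
        for z :: "bool list \<times> real"
        by (simp add: power2_eq_square algebra_simps)
      show ?thesis
        unfolding eq by (intro Bochner_Integration.integrable_add Bochner_Integration.integrable_diff
            integrable_mult_right integrable_label_sq integrable_label_point integrable_point)
    qed
    show "integrable P (\<lambda>z. (f (fst z) - truncate n d f (fst z))\<^sup>2)"
      by (rule integrable_point)
    have "integrable P (\<lambda>z. snd z * (f (fst z) - truncate n d f (fst z))
        - f (fst z) * (f (fst z) - truncate n d f (fst z)))"
      by (intro Bochner_Integration.integrable_diff integrable_label_point integrable_point)
    then show "integrable P (\<lambda>z. (snd z - f (fst z)) * (f (fst z) - truncate n d f (fst z)))"
      by (simp add: left_diff_distrib)
  qed
  also have "sqrt (\<integral>z. (f (fst z) - truncate n d f (fst z))\<^sup>2 \<partial>P) \<le> \<epsilon> / 2"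
  proof -
    have "(\<integral>z. (f (fst z) - truncate n d f (fst z))\<^sup>2 \<partial>P) \<le> 1 / (real d + 1)\<^sup>2"
      using xos_truncation_error[OF f, of d] integral_point[of "\<lambda>x. (f x - truncate n d f x)\<^sup>2"] by simp
    also have "\<dots> = (1 / (real d + 1))\<^sup>2" by (simp add: power_divide)
    also have "\<dots> \<le> (\<epsilon> / 2)\<^sup>2"
      using d by (intro power_mono) (auto simp: field_simps)
    finally show ?thesis using \<epsilon> by (intro real_le_lsqrt) auto
  qed
  finally have "sqrt r \<le> l2_error P f + \<epsilon> / 2" by simp
  moreover have "l2_error P (\<lambda>x. \<Sum>S\<in>?A. c S * walsh S x) \<le> sqrt r + \<epsilon> / 2"
  proof -
    have "l2_error P (\<lambda>x. \<Sum>S\<in>?A. c S * walsh S x) \<le> sqrt (r + (\<epsilon> / 2)\<^sup>2)"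
      unfolding l2_error_eq expand using c by simp
    also have "\<dots> \<le> sqrt r + sqrt ((\<epsilon> / 2)\<^sup>2)"
      using \<open>0 \<le> r\<close> by (intro sqrt_add_le_add_sqrt) auto
    finally show ?thesis using \<epsilon> by simp
  qed
  ultimately show ?thesis by simp
qed

lemma xos_class_nonempty: "(\<lambda>_. 0) \<in> xos_class n"
  unfolding xos_class_def xos_def by (auto intro!: exI[of _ "{0}"] exI[of _ "\<lambda>_ _. 0"])

text \<open>Comparing with every \<open>f\<close> separately suffices, so no optimal
  \<open>f\<close> has to be exhibited; the zero function makes the infimum range over a nonempty
  set.\<close>

lemma le_opt_add:
  assumes "\<And>f. f \<in> xos_class n \<Longrightarrow> e \<le> l2_error P f + \<epsilon>"
  shows "e \<le> opt P (xos_class n) + \<epsilon>"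
proof -
  have "e - \<epsilon> \<le> (INF f\<in>xos_class n. l2_error P f)"
    using assms xos_class_nonempty by (intro cINF_greatest) (auto simp: algebra_simps)
  then show ?thesis by (simp add: opt_def)
qed

lemma empirical_measurable [measurable]:
  "(\<lambda>\<omega>. empirical m \<omega> S) \<in> borel_measurable (\<Pi>\<^sub>M j\<in>(UNIV :: nat set). P)"
proof -
  have "(\<lambda>z. snd z * walsh S (fst z)) \<in> borel_measurable P"
    using measurable_point[of "walsh S"] by measurable
  then show ?thesis
    unfolding empirical_def
    by (intro borel_measurable_divide borel_measurable_sum borel_measurable_const
        iid_measurable[of "\<lambda>z. snd z * walsh S (fst z)"])
qed

text \<open>The variance of a single term is at most its second moment, which is that of the label
  since \<open>walsh S\<close> squares to 1. Averaging \<open>m\<close> independent terms divides it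
  by \<open>m\<close>.\<close>

lemma empirical_variance:
  assumes "0 < m"
  shows "integrable (\<Pi>\<^sub>M j\<in>(UNIV :: nat set). P) (\<lambda>\<omega>. (empirical m \<omega> S - correlation S)\<^sup>2)" (is ?int)
    and "(\<integral>\<omega>. (empirical m \<omega> S - correlation S)\<^sup>2 \<partial>(\<Pi>\<^sub>M j\<in>(UNIV :: nat set). P)) \<le> 1 / m" (is ?le)
proof -
  define Y where "Y z = snd z * walsh S (fst z) - correlation S" for z
  have [measurable]: "Y \<in> borel_measurable P"
    unfolding Y_def using measurable_point[of "walsh S"] by measurable
  have walsh_abs: "\<bar>walsh S x\<bar> = 1" for x
    unfolding walsh_def abs_prod by (intro prod.neutral) (simp add: sgn_bit_def)
  have bound: "\<bar>Y z\<bar> \<le> 1 + \<bar>correlation S\<bar>" if "z \<in> space P" for z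
  proof -
    have "\<bar>Y z\<bar> \<le> \<bar>snd z * walsh S (fst z)\<bar> + \<bar>correlation S\<bar>"
      unfolding Y_def by (rule abs_triangle_ineq4)
    moreover have "\<bar>snd z * walsh S (fst z)\<bar> \<le> 1"
      using that by (auto simp: space_P abs_mult walsh_abs)
    ultimately show ?thesis by simp
  qed
  have centered: "(\<integral>z. Y z \<partial>P) = 0"
    unfolding Y_def by (simp add: integrable_label_point correlation_def prob_space)
  have eq: "(empirical m \<omega> S - correlation S)\<^sup>2 = (\<Sum>j<m. Y (\<omega> j))\<^sup>2 / (real m)\<^sup>2" for \<omega>
  proof -
    have "empirical m \<omega> S - correlation S = (\<Sum>j<m. Y (\<omega> j)) / m"
      using assms by (simp add: empirical_def Y_def sum_subtractf field_simps)
    then show ?thesis by (simp add: power_divide)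
  qed
  note iid = integral_iid_sum_sq[OF \<open>Y \<in> borel_measurable P\<close> bound centered, of m]
  show ?int unfolding eq using iid(1) by simp
  have "(\<integral>z. (Y z)\<^sup>2 \<partial>P) = (\<integral>z. (snd z)\<^sup>2 - 2 * correlation S * (snd z * walsh S (fst z)) + (correlation S)\<^sup>2 \<partial>P)"
  proof (intro Bochner_Integration.integral_cong refl)
    fix z
    have "(Y z)\<^sup>2 = (snd z)\<^sup>2 * (walsh S (fst z) * walsh S (fst z))
        - 2 * correlation S * (snd z * walsh S (fst z)) + (correlation S)\<^sup>2"
      by (simp only: Y_def power2_eq_square) (simp add: algebra_simps)
    then show "(Y z)\<^sup>2 = (snd z)\<^sup>2 - 2 * correlation S * (snd z * walsh S (fst z)) + (correlation S)\<^sup>2"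
      by simp
  qed
  also have "\<dots> = (\<integral>z. (snd z)\<^sup>2 \<partial>P) - (correlation S)\<^sup>2"
    by (simp add: integrable_label_sq integrable_label_point prob_space flip: correlation_def)
      (simp add: power2_eq_square)
  also have "\<dots> \<le> (\<integral>z. 1 \<partial>P) - 0"
    by (intro diff_mono integral_mono integrable_label_sq) (auto simp: space_P power_le_one)
  finally have "(\<integral>z. (Y z)\<^sup>2 \<partial>P) \<le> 1" by (simp add: prob_space)
  then have "real m * (\<integral>z. (Y z)\<^sup>2 \<partial>P) / (real m)\<^sup>2 \<le> real m * 1 / (real m)\<^sup>2"
    by (intro divide_right_mono mult_left_mono) auto
  then show ?le
    unfolding eq using iid(2) assms by (simp add: power2_eq_square)
qed

text \<open>The expected squared distance \<open>Z\<close> between empirical and true coefficients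
  is at most \<open>(real n + 1) ^ d / m\<close>, hence at most
  \<open>\<epsilon>\<^sup>2 / 12\<close>. Markov's inequality at the threshold
  \<open>(\<epsilon> / 2)\<^sup>2\<close> then gives failure probability 1/3; this is where the 12
  comes from.\<close>

lemma empirical_low_degree_learns:
  assumes d: "2 \<le> (real d + 1) * \<epsilon>" and \<epsilon>: "0 < \<epsilon>" and m: "12 / \<epsilon>\<^sup>2 * (real n + 1) ^ d \<le> real m"
  shows "2 / 3 \<le> measure (\<Pi>\<^sub>M i\<in>(UNIV :: nat set). P)
    {\<omega> \<in> space (\<Pi>\<^sub>M i\<in>(UNIV :: nat set). P).
      l2_error P (\<lambda>x. \<Sum>S\<in>low_degree n d. empirical m \<omega> S * walsh S x) \<le> opt P (xos_class n) + \<epsilon>}"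
proof -
  let ?P = "\<Pi>\<^sub>M i\<in>(UNIV :: nat set). P" and ?A = "low_degree n d"
  interpret iid: prob_space ?P by (intro prob_space_PiM prob_space_axioms)
  define Z where "Z \<omega> = (\<Sum>S\<in>?A. (empirical m \<omega> S - correlation S)\<^sup>2)" for \<omega>
  have [measurable]: "Z \<in> borel_measurable ?P" unfolding Z_def by measurable
  have "0 < 12 / \<epsilon>\<^sup>2 * (real n + 1) ^ d" using \<epsilon> by simp
  then have "0 < m" using m by linarith
  have "integrable ?P Z"
    unfolding Z_def using empirical_variance[OF \<open>0 < m\<close>] by auto
  have "(\<integral>\<omega>. Z \<omega> \<partial>?P) \<le> (\<Sum>S\<in>?A. 1 / m)"
  proof -
    have "(\<integral>\<omega>. Z \<omega> \<partial>?P) = (\<Sum>S\<in>?A. \<integral>\<omega>. (empirical m \<omega> S - correlation S)\<^sup>2 \<partial>?P)"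
      unfolding Z_def using empirical_variance(1)[OF \<open>0 < m\<close>]
      by (intro Bochner_Integration.integral_sum) auto
    also have "\<dots> \<le> (\<Sum>S\<in>?A. 1 / m)"
      using empirical_variance(2)[OF \<open>0 < m\<close>] by (rule sum_mono)
    finally show ?thesis .
  qed
  also have "\<dots> \<le> (real n + 1) ^ d / m"
    using card_low_degree_le[of n d] by (simp add: divide_right_mono)
  finally have "(\<integral>\<omega>. Z \<omega> \<partial>?P) / (\<epsilon> / 2)\<^sup>2 \<le> (real n + 1) ^ d / m / (\<epsilon> / 2)\<^sup>2"
    by (intro divide_right_mono) auto
  also have "\<dots> \<le> 1 / 3"
    using m \<epsilon> \<open>0 < m\<close> by (simp add: field_simps power2_eq_square)
  finally have "(\<integral>\<omega>. Z \<omega> \<partial>?P) / (\<epsilon> / 2)\<^sup>2 \<le> 1 / 3" .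
  moreover have "measure ?P {\<omega>\<in>space ?P. (\<epsilon> / 2)\<^sup>2 \<le> Z \<omega>} \<le> (\<integral>\<omega>. Z \<omega> \<partial>?P) / (\<epsilon> / 2)\<^sup>2"
    using \<epsilon> by (intro integral_Markov_inequality_measure[OF \<open>integrable ?P Z\<close> sets.top])
      (auto simp: Z_def sum_nonneg)
  ultimately have markov: "measure ?P {\<omega>\<in>space ?P. (\<epsilon> / 2)\<^sup>2 \<le> Z \<omega>} \<le> 1 / 3"
    by (rule order_trans[rotated])
  have "2 / 3 \<le> 1 - measure ?P {\<omega>\<in>space ?P. (\<epsilon> / 2)\<^sup>2 \<le> Z \<omega>}"
    using markov by simp
  also have "\<dots> = measure ?P (space ?P - {\<omega>\<in>space ?P. (\<epsilon> / 2)\<^sup>2 \<le> Z \<omega>})"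
    by (rule iid.prob_compl[symmetric]) measurable
  also have "\<dots> \<le> measure ?P {\<omega> \<in> space ?P.
      l2_error P (\<lambda>x. \<Sum>S\<in>?A. empirical m \<omega> S * walsh S x) \<le> opt P (xos_class n) + \<epsilon>}"
  proof (rule iid.finite_measure_mono)
    \<comment> \<open>The error depends on the sample only through \<open>Z\<close>, which makes the
      success event measurable.\<close>
    have "l2_error P (\<lambda>x. \<Sum>S\<in>?A. empirical m \<omega> S * walsh S x)
        = sqrt ((\<integral>z. (snd z)\<^sup>2 \<partial>P) - (\<Sum>S\<in>?A. (correlation S)\<^sup>2) + Z \<omega>)" for \<omega>
      unfolding l2_error_eq Z_def by (subst sq_error_expansion) (auto simp: low_degree_def)
    then show "{\<omega> \<in> space ?P. l2_error P (\<lambda>x. \<Sum>S\<in>?A. empirical m \<omega> S * walsh S x)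
        \<le> opt P (xos_class n) + \<epsilon>} \<in> sets ?P"
      by simp
    show "space ?P - {\<omega>\<in>space ?P. (\<epsilon> / 2)\<^sup>2 \<le> Z \<omega>} \<subseteq> {\<omega> \<in> space ?P.
        l2_error P (\<lambda>x. \<Sum>S\<in>?A. empirical m \<omega> S * walsh S x) \<le> opt P (xos_class n) + \<epsilon>}"
      using d \<epsilon> by (auto intro!: le_opt_add l2_error_low_degree_le simp: Z_def)
  qed
  finally show ?thesis .
qed

text \<open>Labels lie in the unit interval, so predicting 0 has error at most 1, while the error of
  any competitor is nonnegative.\<close>

lemma l2_error_zero_le:
  assumes "1 \<le> \<epsilon>"
  shows "l2_error P (\<lambda>x. 0) \<le> opt P (xos_class n) + \<epsilon>"
proof -
  have "(\<integral>z. (snd z)\<^sup>2 \<partial>P) \<le> (\<integral>z. 1 \<partial>P)"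
    by (intro integral_mono integrable_label_sq) (auto simp: space_P power_le_one)
  then have "l2_error P (\<lambda>x. 0) \<le> 1"
    by (simp add: l2_error_eq prob_space)
  moreover have "0 \<le> l2_error P f" for f
    by (simp add: l2_error_eq)
  ultimately show ?thesis
    using assms by (intro le_opt_add) (smt (verit))
qed

end

section \<open>The program\<close>

definition halts :: "com \<Rightarrow> state \<Rightarrow> nat \<Rightarrow> (state \<Rightarrow> bool) \<Rightarrow> bool" where
  "halts c s T Q \<longleftrightarrow> (\<exists>t s'. exec c s t s' \<and> t \<le> T \<and> Q s')"

text \<open>An equivalence rather than an implication, so that the simplifier can run straight-line
  code; the forward direction rests on determinism of \<open>exec\<close>.\<close>

lemma halts_exec:
  assumes "exec c s 1 s'"
  shows "halts c s T Q \<longleftrightarrow> 1 \<le> T \<and> Q s'"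
  unfolding halts_def using assms exec_deterministic by blast

lemma halts_Seq_exec:
  assumes "exec c1 s 1 s1"
  shows "halts (Seq c1 c2) s T Q \<longleftrightarrow> 1 \<le> T \<and> halts c2 s1 (T - 1) Q"
proof
  assume "halts (Seq c1 c2) s T Q"
  then obtain t s' where "exec (Seq c1 c2) s t s'" "t \<le> T" "Q s'"
    by (auto simp: halts_def)
  from this(1) obtain t1 r t2 where "t = t1 + t2" "exec c1 s t1 r" "exec c2 r t2 s'"
    by (rule exec_SeqE)
  moreover have "t1 = 1" "r = s1"
    using exec_deterministic[OF assms \<open>exec c1 s t1 r\<close>] by auto
  ultimately have "1 \<le> T" "exec c2 s1 t2 s'" "t2 \<le> T - 1" using \<open>t \<le> T\<close> by auto
  then show "1 \<le> T \<and> halts c2 s1 (T - 1) Q"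
    using \<open>Q s'\<close> unfolding halts_def by blast
next
  assume *: "1 \<le> T \<and> halts c2 s1 (T - 1) Q"
  then obtain t s' where "exec c2 s1 t s'" "t \<le> T - 1" "Q s'" by (auto simp: halts_def)
  then have "exec (Seq c1 c2) s (1 + t) s'" "1 + t \<le> T"
    using exec.Seq[OF assms] * by auto
  then show "halts (Seq c1 c2) s T Q" using \<open>Q s'\<close> unfolding halts_def by blast
qed

lemmas halts_simps =
  halts_exec[OF exec.Skip] halts_exec[OF exec.NStore] halts_exec[OF exec.RStore] halts_exec[OF exec.Draw]
  halts_Seq_exec[OF exec.NStore] halts_Seq_exec[OF exec.RStore] halts_Seq_exec[OF exec.Draw]

lemma halts_Seq:
  assumes "halts c1 s T1 R" "\<And>s'. R s' \<Longrightarrow> halts c2 s' T2 Q" "T1 + T2 \<le> T"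
  shows "halts (Seq c1 c2) s T Q"
proof -
  obtain t1 s1 where 1: "exec c1 s t1 s1" "t1 \<le> T1" "R s1"
    using assms(1) by (auto simp: halts_def)
  obtain t2 s2 where 2: "exec c2 s1 t2 s2" "t2 \<le> T2" "Q s2"
    using assms(2)[OF 1(3)] by (auto simp: halts_def)
  show ?thesis
    unfolding halts_def
    by (intro exI[of _ "t1 + t2"] exI[of _ s2] conjI exec.Seq[OF 1(1) 2(1)]) (use 1 2 assms(3) in auto)
qed

lemma halts_If:
  assumes "bval b s \<Longrightarrow> halts c1 s T Q" "\<not> bval b s \<Longrightarrow> halts c2 s T Q"
  shows "halts (If b c1 c2) s (Suc T) Q"
  using assms exec.IfTrue exec.IfFalse unfolding halts_def by (metis Suc_le_mono)

text \<open>The invariant is indexed by the number of completed rounds, and the loop makes exactly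
  \<open>k\<close> of them. Each round costs its body and one test; the final failing test adds
  1.\<close>

lemma halts_While:
  assumes "Inv 0 s"
    and "\<And>i s. i < k \<Longrightarrow> Inv i s \<Longrightarrow> bval b s \<and> halts c s T (Inv (Suc i))"
    and "\<And>s. Inv k s \<Longrightarrow> \<not> bval b s"
  shows "halts (While b c) s (k * (T + 1) + 1) (Inv k)"
proof -
  have "halts (While b c) s ((k - i) * (T + 1) + 1) (Inv k)" if "i \<le> k" "Inv i s" for i s
    using that
  proof (induction "k - i" arbitrary: i s)
    case 0
    then have "\<not> bval b s" using assms(3) by simp
    then show ?case
      using 0 exec.WhileFalse unfolding halts_def by (intro exI[of _ 1] exI[of _ s]) auto
  next
    case (Suc l)
    then have "i < k" by simp
    then obtain t1 s1 where 1: "bval b s" "exec c s t1 s1" "t1 \<le> T" "Inv (Suc i) s1"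
      using assms(2)[of i s] Suc.prems(2) by (auto simp: halts_def)
    obtain t2 s2 where 2: "exec (While b c) s1 t2 s2" "t2 \<le> (k - Suc i) * (T + 1) + 1" "Inv k s2"
    proof -
      have "l = k - Suc i" using Suc.hyps(2) by simp
      then have "halts (While b c) s1 ((k - Suc i) * (T + 1) + 1) (Inv k)"
        using Suc.hyps(1) \<open>i < k\<close> 1(4) by simp
      then show ?thesis unfolding halts_def using that by blast
    qed
    have "k - i = Suc (k - Suc i)" using \<open>i < k\<close> by simp
    then have "Suc (t1 + t2) \<le> (k - i) * (T + 1) + 1" using 1(3) 2(2) by simp
    then show ?case
      using exec.WhileTrue[OF 1(1,2) 2(1)] 2(3) unfolding halts_def by blast
  qed
  then show ?thesis using assms(1) by force
qed

lemma halts_mono: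
  assumes "halts c s T Q" "T \<le> T'" "\<And>s'. Q s' \<Longrightarrow> Q' s'"
  shows "halts c s T' Q'"
  using assms unfolding halts_def by (meson order_trans)

section \<open>The training and prediction programs\<close>

abbreviation seq :: "com \<Rightarrow> com \<Rightarrow> com" (infixr ";;" 60) where
  "c1 ;; c2 \<equiv> Seq c1 c2"

abbreviation reg :: "nat \<Rightarrow> nexp" where
  "reg a \<equiv> NMem (NConst a)"

abbreviation set_reg :: "nat \<Rightarrow> nexp \<Rightarrow> com" where
  "set_reg a e \<equiv> NStore (NConst a) e"

abbreviation inc :: "nat \<Rightarrow> com" where
  "inc a \<equiv> set_reg a (NAdd (reg a) (NConst 1))"

abbreviation rconst :: "nat \<Rightarrow> rexp" where
  "rconst k \<equiv> RNat (NConst k)"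

abbreviation rreg :: "nat \<Rightarrow> rexp" where
  "rreg a \<equiv> RMem (NConst a)"

abbreviation set_rreg :: "nat \<Rightarrow> rexp \<Rightarrow> com" where
  "set_rreg a e \<equiv> RStore (NConst a) e"

text \<open>
  Natural registers: 0 holds the dimension n, 1 the degree d, 2 the sample size m, 3 the address
  of the next record entry, 4 a bit index, 5 a table index, 6 a sample index. Real cells: 0 holds
  \<open>\<epsilon>\<close> and later the output, 1 and 2 are scratch, 3 to d + 3 hold the kernel table, and from d + 4
  on there is one record of n + 1 entries per example, its label followed by the signs of its bits.
\<close>

abbreviation bit_sign :: rexp where
  "bit_sign \<equiv> RSub (rconst 1) (RMul (rconst 2) (RNat (NBit (reg 4))))"

text \<open>Without a floor operation the degree is found by trial. Real cell 1 starts at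
  \<open>12 / \<epsilon>\<^sup>2\<close> and gains a factor \<open>n + 1\<close> with each degree,
  so it ends as the required sample size.\<close>

definition choose_size :: com where
  "choose_size = While (BNot (RLe (rconst 2) (RMul (RNat (NAdd (reg 1) (NConst 1))) (rreg 0))))
     (inc 1 ;; set_rreg 1 (RMul (rreg 1) (RNat (NAdd (reg 0) (NConst 1)))))"

definition store_bits :: com where
  "store_bits = While (BNot (NLe (reg 0) (reg 4))) (RStore (reg 3) bit_sign ;; inc 3 ;; inc 4)"

text \<open>Drawing until the cast of register 2 reaches the real bound in cell 1 rounds that bound
  up to a natural number.\<close>

definition store_sample :: com where
  "store_sample = While (BNot (RLe (rreg 1) (RNat (reg 2))))
     (Draw ;; RStore (reg 3) RLabel ;; inc 3 ;; set_reg 4 (NConst 0) ;; store_bits ;; inc 2)"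

text \<open>For \<epsilon> at least 1 the registers 1 and 2 keep their initial 0, which encodes
  degree 0 and an empty sample.\<close>

definition trainer :: com where
  "trainer = If (RLe (rconst 1) (rreg 0)) Skip
     (set_rreg 1 (RDiv (rconst 12) (RMul (rreg 0) (rreg 0))) ;; choose_size ;;
      set_reg 3 (NAdd (reg 1) (NConst 4)) ;; store_sample)"

definition init_table :: com where
  "init_table = While (NLe (reg 5) (reg 1)) (RStore (NAdd (NConst 3) (reg 5)) (rconst 1) ;; inc 5)"

text \<open>Entry \<open>k\<close> has address \<open>3 + k\<close>. Going downwards keeps entry
  \<open>k - 1\<close>, at address \<open>2 + k\<close>, at its old value until entry
  \<open>k\<close> has used it; entry 0 stays 1.\<close>

definition update_table :: com where
  "update_table = While (NLe (NConst 1) (reg 5))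
     (RStore (NAdd (NConst 3) (reg 5))
        (RAdd (RMem (NAdd (NConst 3) (reg 5))) (RMul (rreg 1) (RMem (NAdd (NConst 2) (reg 5))))) ;;
      set_reg 5 (NSub (reg 5) (NConst 1)))"

definition eval_kernel :: com where
  "eval_kernel = While (BNot (NLe (reg 0) (reg 4)))
     (set_rreg 1 (RMul (RMem (reg 3)) bit_sign) ;; inc 3 ;; set_reg 5 (reg 1) ;; update_table ;; inc 4)"

text \<open>Each round consumes exactly one record, so the pointer in register 3 is set only once.
  An empty sample yields the prediction 0, since division by 0 gives 0.\<close>

definition predictor :: com where
  "predictor = set_rreg 0 (rconst 0) ;; set_reg 6 (NConst 0) ;; set_reg 3 (NAdd (reg 1) (NConst 4)) ;;
     While (BNot (NLe (reg 2) (reg 6)))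
       (set_reg 5 (NConst 0) ;; init_table ;; set_rreg 2 (RMem (reg 3)) ;; inc 3 ;;
        set_reg 4 (NConst 0) ;; eval_kernel ;;
        set_rreg 0 (RAdd (rreg 0) (RMul (rreg 2) (RMem (NAdd (NConst 3) (reg 1))))) ;; inc 6) ;;
     set_rreg 0 (RDiv (rreg 0) (RNat (reg 2)))"

section \<open>Layout of the stored sample\<close>

definition rec_addr :: "nat \<Rightarrow> nat \<Rightarrow> nat \<Rightarrow> nat" where
  "rec_addr n d j = d + 4 + j * (n + 1)"

lemma rec_addr_0 [simp]: "rec_addr n d 0 = d + 4"
  and rec_addr_Suc: "rec_addr n d (Suc j) = rec_addr n d j + n + 1"
  and rec_addr_ge: "d + 4 \<le> rec_addr n d j"
  by (simp_all add: rec_addr_def)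

lemma rec_addr_less: "i < j \<Longrightarrow> rec_addr n d i + n < rec_addr n d j"
proof (induction j)
  case (Suc j)
  then show ?case by (cases "i = j") (auto simp: rec_addr_Suc)
qed simp

definition stored :: "nat \<Rightarrow> nat \<Rightarrow> (nat \<Rightarrow> bool list \<times> real) \<Rightarrow> nat \<Rightarrow> (nat \<Rightarrow> real) \<Rightarrow> bool" where
  "stored n d \<omega> m r \<longleftrightarrow> (\<forall>j<m. r (rec_addr n d j) = snd (\<omega> j) \<and>
     (\<forall>i<n. r (rec_addr n d j + 1 + i) = sgn_bit (fst (\<omega> j)) i))"

text \<open>Frame rule for the scratch cells and the kernel table, which lie below the first record;
  \<open>stored_upd_high\<close> is its counterpart for the record being written.\<close>

lemma stored_upd_low: "a < d + 4 \<Longrightarrow> stored n d \<omega> m (r(a := v)) \<longleftrightarrow> stored n d \<omega> m r"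
proof -
  assume "a < d + 4"
  then have "rec_addr n d j \<noteq> a" "rec_addr n d j + 1 + i \<noteq> a" for i j
    using rec_addr_ge[of d n j] by linarith+
  then show ?thesis by (simp add: stored_def)
qed

lemma stored_upd_high: "rec_addr n d m \<le> a \<Longrightarrow> stored n d \<omega> m (r(a := v)) \<longleftrightarrow> stored n d \<omega> m r"
  using rec_addr_less[of _ m n d] by (fastforce simp: stored_def)

text \<open>The index must be in range: beyond the end \<open>NBit\<close> reads 0, whereas
  \<open>!\<close> is unspecified.\<close>

lemma bit_sign_val:
  "nmem s 4 < length (point s) \<Longrightarrow> rval bit_sign s = sgn_bit (point s) (nmem s 4)"
  by (simp add: sgn_bit_def)

lemma store_bits_halts:
  assumes "length x = n" "nmem s 0 = n" "nmem s 1 = d" "nmem s 2 = j" "nmem s 3 = rec_addr n d j + 1"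
    "nmem s 4 = 0" "rmem s 1 = B" "sample s = \<omega>'" "point s = x" "stored n d \<omega> j (rmem s)"
    "rmem s (rec_addr n d j) = l"
  shows "halts store_bits s (n * 4 + 1) (\<lambda>s. nmem s 0 = n \<and> nmem s 1 = d \<and> nmem s 2 = j \<and>
     nmem s 3 = rec_addr n d (Suc j) \<and> rmem s 1 = B \<and> sample s = \<omega>' \<and> stored n d \<omega> j (rmem s) \<and>
     rmem s (rec_addr n d j) = l \<and> (\<forall>i<n. rmem s (rec_addr n d j + 1 + i) = sgn_bit x i))"
proof -
  define Inv where "Inv i s \<longleftrightarrow> nmem s 0 = n \<and> nmem s 1 = d \<and> nmem s 2 = j \<and>
     nmem s 3 = rec_addr n d j + 1 + i \<and> nmem s 4 = i \<and> rmem s 1 = B \<and> sample s = \<omega>' \<and> point s = x \<and>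
     stored n d \<omega> j (rmem s) \<and> rmem s (rec_addr n d j) = l \<and>
     (\<forall>i'<i. rmem s (rec_addr n d j + 1 + i') = sgn_bit x i')" for i and s :: state
  have "halts store_bits s (n * (3 + 1) + 1) (Inv n)"
    unfolding store_bits_def
  proof (rule halts_While)
    show "Inv 0 s" using assms by (simp add: Inv_def)
    fix i s assume i: "i < n" and inv: "Inv i s"
    have "d + 4 \<le> rec_addr n d j" by (rule rec_addr_ge)
    then show "bval (BNot (NLe (reg 0) (reg 4))) s \<and>
        halts (RStore (reg 3) bit_sign ;; inc 3 ;; inc 4) s 3 (Inv (Suc i))"
      using i inv bit_sign_val[of s] assms(1)
      by (simp add: halts_simps Inv_def stored_upd_high less_Suc_eq del: rval.simps(5))
  qed (simp add: Inv_def)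
  then show ?thesis
    by (rule halts_mono) (simp_all add: Inv_def rec_addr_Suc)
qed

text \<open>The two conditions on \<open>B\<close> say that \<open>m\<close> is \<open>B\<close>
  rounded up, so the guard holds for exactly \<open>m\<close> rounds. A round takes
  \<open>4 * n + 1\<close> steps for the bits, five further commands and one test.\<close>

lemma store_sample_halts:
  assumes "\<And>j. length (fst (\<omega> j)) = n" and m: "B \<le> real m" "\<And>j. j < m \<Longrightarrow> real j < B"
    and "nmem s 0 = n" "nmem s 1 = d" "nmem s 2 = 0" "nmem s 3 = d + 4" "rmem s 1 = B" "sample s = \<omega>"
  shows "halts store_sample s (m * (4 * n + 7) + 1) (\<lambda>s. nmem s 0 = n \<and> nmem s 1 = d \<and> nmem s 2 = m \<and>
     stored n d \<omega> m (rmem s))"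
proof -
  define Inv where "Inv j s \<longleftrightarrow> nmem s 0 = n \<and> nmem s 1 = d \<and> nmem s 2 = j \<and>
     nmem s 3 = rec_addr n d j \<and> rmem s 1 = B \<and> sample s = (\<lambda>i. \<omega> (i + j)) \<and> stored n d \<omega> j (rmem s)" for j and s :: state
  have "halts store_sample s (m * (4 * n + 6 + 1) + 1) (Inv m)"
    unfolding store_sample_def
  proof (rule halts_While)
    show "Inv 0 s" using assms by (simp add: Inv_def stored_def)
    fix j s assume j: "j < m" and inv: "Inv j s"
    have ge: "d + 4 \<le> rec_addr n d j" by (rule rec_addr_ge)
    have "halts (store_bits ;; inc 2) s' (4 * n + 2) (Inv (Suc j))"
      if s': "nmem s' 0 = n" "nmem s' 1 = d" "nmem s' 2 = j" "nmem s' 3 = rec_addr n d j + 1"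
        "nmem s' 4 = 0" "rmem s' 1 = B" "sample s' = (\<lambda>i. \<omega> (i + Suc j))" "point s' = fst (\<omega> j)"
        "stored n d \<omega> j (rmem s')" "rmem s' (rec_addr n d j) = snd (\<omega> j)" for s'
      by (rule halts_Seq[OF store_bits_halts[OF assms(1) s'], where ?T2.0 = 1])
        (simp_all add: halts_simps Inv_def stored_def less_Suc_eq all_conj_distrib)
    then show "bval (BNot (RLe (rreg 1) (RNat (reg 2)))) s \<and>
        halts (Draw ;; RStore (reg 3) RLabel ;; inc 3 ;; set_reg 4 (NConst 0) ;; store_bits ;; inc 2) s
          (4 * n + 6) (Inv (Suc j))"
      using inv m(2)[OF j] ge by (simp add: halts_simps Inv_def stored_upd_high)
  qed (use m in \<open>simp add: Inv_def\<close>)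
  then show ?thesis
    by (rule halts_mono) (simp_all add: Inv_def)
qed

section \<open>Degree and sample size\<close>

definition degree_for :: "real \<Rightarrow> nat" where
  "degree_for \<epsilon> = (LEAST d. 2 \<le> (real d + 1) * \<epsilon>)"

definition sample_bound :: "nat \<Rightarrow> real \<Rightarrow> real" where
  "sample_bound n \<epsilon> = 12 / \<epsilon>\<^sup>2 * (real n + 1) ^ degree_for \<epsilon>"

definition size_for :: "nat \<Rightarrow> real \<Rightarrow> nat" where
  "size_for n \<epsilon> = nat \<lceil>sample_bound n \<epsilon>\<rceil>"

text \<open>The ceiling of \<open>2 / \<epsilon>\<close> shows that a suitable degree exists.
  Minimality keeps the guard of \<open>choose_size\<close> true in all earlier rounds and later
  bounds the degree by \<open>2 / \<epsilon>\<close>.\<close>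

lemma degree_for:
  assumes "0 < \<epsilon>"
  shows "2 \<le> (real (degree_for \<epsilon>) + 1) * \<epsilon>"
    and "d < degree_for \<epsilon> \<Longrightarrow> (real d + 1) * \<epsilon> < 2"
proof -
  have "2 \<le> (real (nat \<lceil>2 / \<epsilon>\<rceil>) + 1) * \<epsilon>"
  proof -
    have "2 / \<epsilon> \<le> real (nat \<lceil>2 / \<epsilon>\<rceil>) + 1" using real_nat_ceiling_ge[of "2 / \<epsilon>"] by linarith
    then show ?thesis using assms by (simp only: pos_divide_le_eq)
  qed
  then show "2 \<le> (real (degree_for \<epsilon>) + 1) * \<epsilon>"
    unfolding degree_for_def by (rule LeastI)
  show "d < degree_for \<epsilon> \<Longrightarrow> (real d + 1) * \<epsilon> < 2"
    unfolding degree_for_def using not_less_Least by force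
qed

lemma size_for: "sample_bound n \<epsilon> \<le> real (size_for n \<epsilon>)"
  "j < size_for n \<epsilon> \<Longrightarrow> real j < sample_bound n \<epsilon>"
  by (simp_all add: size_for_def real_nat_ceiling_ge zless_nat_eq_int_zless less_ceiling_iff)

lemma choose_size_halts:
  assumes "0 < \<epsilon>" "nmem s 0 = n" "nmem s 1 = 0" "nmem s 2 = 0" "rmem s 0 = \<epsilon>" "rmem s 1 = 12 / \<epsilon>\<^sup>2"
    "sample s = \<omega>"
  shows "halts choose_size s (degree_for \<epsilon> * 3 + 1) (\<lambda>s. nmem s 0 = n \<and> nmem s 1 = degree_for \<epsilon> \<and>
     nmem s 2 = 0 \<and> rmem s 1 = sample_bound n \<epsilon> \<and> sample s = \<omega>)"
proof -
  define Inv where "Inv d s \<longleftrightarrow> nmem s 0 = n \<and> nmem s 1 = d \<and> nmem s 2 = 0 \<and> rmem s 0 = \<epsilon> \<and>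
    rmem s 1 = 12 / \<epsilon>\<^sup>2 * (real n + 1) ^ d \<and> sample s = \<omega>" for d and s :: state
  have "halts choose_size s (degree_for \<epsilon> * (2 + 1) + 1) (Inv (degree_for \<epsilon>))"
    unfolding choose_size_def
  proof (rule halts_While)
    show "Inv 0 s" using assms by (simp add: Inv_def)
    fix d s assume "d < degree_for \<epsilon>" "Inv d s"
    then show "bval (BNot (RLe (rconst 2) (RMul (RNat (NAdd (reg 1) (NConst 1))) (rreg 0)))) s \<and>
        halts (inc 1 ;; set_rreg 1 (RMul (rreg 1) (RNat (NAdd (reg 0) (NConst 1))))) s 2 (Inv (Suc d))"
      using degree_for(2)[OF assms(1), of d] by (simp add: halts_simps Inv_def add.commute)
  next
    fix s assume "Inv (degree_for \<epsilon>) s"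
    then show "\<not> bval (BNot (RLe (rconst 2) (RMul (RNat (NAdd (reg 1) (NConst 1))) (rreg 0)))) s"
      using degree_for(1)[OF assms(1)] by (simp add: Inv_def add.commute)
  qed
  then show ?thesis
    by (rule halts_mono) (simp_all add: Inv_def sample_bound_def)
qed

definition trained :: "nat \<Rightarrow> nat \<Rightarrow> nat \<Rightarrow> (nat \<Rightarrow> bool list \<times> real) \<Rightarrow> state \<Rightarrow> bool" where
  "trained n d m \<omega> s \<longleftrightarrow> nmem s 0 = n \<and> nmem s 1 = d \<and> nmem s 2 = m \<and> stored n d \<omega> m (rmem s)"

lemma trainer_halts_large:
  assumes "1 \<le> \<epsilon>"
  shows "halts trainer (train_state n \<epsilon> \<omega>) 2 (trained n 0 0 \<omega>)"
  unfolding trainer_def numeral_2_eq_2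
  by (rule halts_If) (use assms in \<open>auto simp: train_state_def halts_simps trained_def stored_def\<close>)

lemma trainer_halts_small:
  assumes "0 < \<epsilon>" "\<epsilon> < 1" and "\<And>j. length (fst (\<omega> j)) = n"
  shows "halts trainer (train_state n \<epsilon> \<omega>)
    (size_for n \<epsilon> * (4 * n + 7) + degree_for \<epsilon> * 3 + 5) (trained n (degree_for \<epsilon>) (size_for n \<epsilon>) \<omega>)"
proof -
  let ?d = "degree_for \<epsilon>" and ?m = "size_for n \<epsilon>"
  have rest: "halts (set_reg 3 (NAdd (reg 1) (NConst 4)) ;; store_sample) s (?m * (4 * n + 7) + 2)
      (trained n ?d ?m \<omega>)"
    if "nmem s 0 = n \<and> nmem s 1 = ?d \<and> nmem s 2 = 0 \<and> rmem s 1 = sample_bound n \<epsilon> \<and> sample s = \<omega>" for s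
    using that store_sample_halts[OF assms(3) size_for, where s = "s\<lparr>nmem := (nmem s)(3 := ?d + 4)\<rparr>" and d = ?d]
    by (simp add: halts_simps trained_def[abs_def])
  have "halts (choose_size ;; set_reg 3 (NAdd (reg 1) (NConst 4)) ;; store_sample)
      (train_state n \<epsilon> \<omega>\<lparr>rmem := (rmem (train_state n \<epsilon> \<omega>))(1 := 12 / \<epsilon>\<^sup>2)\<rparr>)
      (?m * (4 * n + 7) + ?d * 3 + 3) (trained n ?d ?m \<omega>)"
    by (rule halts_Seq[OF choose_size_halts[where \<epsilon> = \<epsilon> and n = n and \<omega> = \<omega>] rest]) (simp_all add: train_state_def assms(1))
  then have "halts (set_rreg 1 (RDiv (rconst 12) (RMul (rreg 0) (rreg 0))) ;; choose_size ;;
      set_reg 3 (NAdd (reg 1) (NConst 4)) ;; store_sample) (train_state n \<epsilon> \<omega>)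
      (?m * (4 * n + 7) + ?d * 3 + 4) (trained n ?d ?m \<omega>)"
    by (simp add: halts_simps) (simp add: train_state_def power2_eq_square add.commute)
  then have "halts trainer (train_state n \<epsilon> \<omega>) (Suc (?m * (4 * n + 7) + ?d * 3 + 4)) (trained n ?d ?m \<omega>)"
    unfolding trainer_def using assms(2) by (intro halts_If) (simp_all add: train_state_def)
  then show ?thesis by (rule halts_mono) simp_all
qed

section \<open>Prediction from the stored sample\<close>

definition prediction ::
    "nat \<Rightarrow> nat \<Rightarrow> (nat \<Rightarrow> bool list \<times> real) \<Rightarrow> bool list \<Rightarrow> nat \<Rightarrow> real" where
  "prediction n d \<omega> x j =
     (\<Sum>j'<j. snd (\<omega> j') * low_degree_sum (\<lambda>i. sgn_bit (fst (\<omega> j')) i * sgn_bit x i) n d)"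

context
  fixes n d m :: nat and \<omega> :: "nat \<Rightarrow> bool list \<times> real" and x :: "bool list"
  assumes len: "length x = n"
begin

definition pframe :: "nat \<Rightarrow> state \<Rightarrow> bool" where
  "pframe j s \<longleftrightarrow> nmem s 0 = n \<and> nmem s 1 = d \<and> nmem s 2 = m \<and> nmem s 6 = j \<and> point s = x \<and>
     stored n d \<omega> m (rmem s) \<and> rmem s 0 = prediction n d \<omega> x j"

definition table :: "(nat \<Rightarrow> real) \<Rightarrow> nat \<Rightarrow> (nat \<Rightarrow> real) \<Rightarrow> bool" where
  "table sg i r \<longleftrightarrow> (\<forall>k\<le>d. r (3 + k) = low_degree_sum sg i k)"

lemma init_table_halts:
  assumes "pframe j s" "nmem s 3 = p" "nmem s 5 = 0"
  shows "halts init_table s ((d + 1) * 3 + 1) (\<lambda>s. pframe j s \<and> nmem s 3 = p \<and> table sg 0 (rmem s))"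
proof -
  define Inv where "Inv k s \<longleftrightarrow> pframe j s \<and> nmem s 3 = p \<and> nmem s 5 = k \<and> (\<forall>k'<k. rmem s (3 + k') = 1)"
    for k and s :: state
  have "halts init_table s ((d + 1) * (2 + 1) + 1) (Inv (d + 1))"
    unfolding init_table_def
  proof (rule halts_While)
    show "Inv 0 s" using assms by (simp add: Inv_def)
    fix k s assume "k < d + 1" and inv: "Inv k s"
    then have "k \<le> d" by simp
    then have "stored n d \<omega> m ((rmem s)(3 + k := 1)) \<longleftrightarrow> stored n d \<omega> m (rmem s)"
      by (intro stored_upd_low) simp
    with \<open>k \<le> d\<close> show "bval (NLe (reg 5) (reg 1)) s \<and>
        halts (RStore (NAdd (NConst 3) (reg 5)) (rconst 1) ;; inc 5) s 2 (Inv (Suc k))"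
      using inv by (simp add: halts_simps Inv_def pframe_def less_Suc_eq)
  qed (simp add: Inv_def pframe_def)
  then show ?thesis
    by (rule halts_mono) (simp_all add: Inv_def table_def)
qed

lemma low_degree_sum_0 [simp]: "low_degree_sum s i 0 = 1"
  by (cases i) simp_all

lemma update_table_halts:
  assumes "pframe j s" "nmem s 3 = p" "nmem s 4 = i" "nmem s 5 = d" "rmem s 1 = sg i" "rmem s 2 = l"
    "table sg i (rmem s)"
  shows "halts update_table s (d * 3 + 1) (\<lambda>s. pframe j s \<and> nmem s 3 = p \<and> nmem s 4 = i \<and>
    rmem s 2 = l \<and> table sg (Suc i) (rmem s))"
proof -
  \<comment> \<open>After \<open>c\<close> rounds the entries above \<open>d - c\<close> belong to
    row \<open>Suc i\<close>, the others still to row \<open>i\<close>.\<close>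
  define Inv where "Inv c s \<longleftrightarrow> pframe j s \<and> nmem s 3 = p \<and> nmem s 4 = i \<and> nmem s 5 = d - c \<and>
    rmem s 1 = sg i \<and> rmem s 2 = l \<and>
    (\<forall>k\<le>d. rmem s (3 + k) = low_degree_sum sg (if d - c < k then Suc i else i) k)" for c and s :: state
  have "halts update_table s (d * (2 + 1) + 1) (Inv d)"
    unfolding update_table_def
  proof (rule halts_While)
    show "Inv 0 s" using assms by (simp add: Inv_def table_def)
    fix c s assume c: "c < d" and inv: "Inv c s"
    obtain k where k: "d - c = Suc k" using c by (metis Suc_diff_Suc)
    then have k': "d - Suc c = k" "k < d" by simp_all
    have tab: "rmem s (3 + k'') = low_degree_sum sg (if Suc k < k'' then Suc i else i) k''" if "k'' \<le> d" for k''
      using inv that by (simp add: Inv_def k)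
    have "rmem s (3 + Suc k) = low_degree_sum sg i (Suc k)" "rmem s (2 + Suc k) = low_degree_sum sg i k"
      using tab[of "Suc k"] tab[of k] k' by (simp_all add: numeral_eq_Suc)
    then show "bval (NLe (NConst 1) (reg 5)) s \<and>
        halts (RStore (NAdd (NConst 3) (reg 5))
            (RAdd (RMem (NAdd (NConst 3) (reg 5))) (RMul (rreg 1) (RMem (NAdd (NConst 2) (reg 5))))) ;;
          set_reg 5 (NSub (reg 5) (NConst 1))) s 2 (Inv (Suc c))"
      using inv k' tab by (simp add: halts_simps Inv_def pframe_def stored_upd_low k)
  qed (simp add: Inv_def)
  then show ?thesis
  proof (rule halts_mono)
    fix s assume "Inv d s"
    then show "pframe j s \<and> nmem s 3 = p \<and> nmem s 4 = i \<and> rmem s 2 = l \<and> table sg (Suc i) (rmem s)"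
      by (auto simp: Inv_def table_def)
  qed simp
qed

text \<open>One round per bit: the stored sign times the sign of the query point is the factor
  \<open>sg i\<close> that advances the table by one row.\<close>

lemma eval_kernel_halts:
  assumes "pframe j s" "j < m" "nmem s 3 = rec_addr n d j + 1" "nmem s 4 = 0" "rmem s 2 = l"
    and sg: "sg = (\<lambda>i. sgn_bit (fst (\<omega> j)) i * sgn_bit x i)" and "table sg 0 (rmem s)"
  shows "halts eval_kernel s (n * (d * 3 + 6) + 1) (\<lambda>s. pframe j s \<and> nmem s 3 = rec_addr n d (Suc j) \<and>
    rmem s 2 = l \<and> table sg n (rmem s))"
proof -
  define Inv where "Inv i s \<longleftrightarrow> pframe j s \<and> nmem s 3 = rec_addr n d j + 1 + i \<and> nmem s 4 = i \<and>
    rmem s 2 = l \<and> table sg i (rmem s)" for i and s :: state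
  have "halts eval_kernel s (n * ((d * 3 + 5) + 1) + 1) (Inv n)"
    unfolding eval_kernel_def
  proof (rule halts_While)
    show "Inv 0 s" using assms by (simp add: Inv_def)
    fix i s assume i: "i < n" and inv: "Inv i s"
    have "rmem s (rec_addr n d j + 1 + i) = sgn_bit (fst (\<omega> j)) i"
      using inv i assms(2) by (simp add: Inv_def pframe_def stored_def)
    moreover have "rval bit_sign s = sgn_bit x i"
      using bit_sign_val[of s] inv i len by (simp add: Inv_def pframe_def)
    moreover have "halts (update_table ;; inc 4) s' (d * 3 + 2) (Inv (Suc i))"
      if s': "pframe j s'" "nmem s' 3 = rec_addr n d j + 1 + Suc i" "nmem s' 4 = i" "nmem s' 5 = d"
        "rmem s' 1 = sg i" "rmem s' 2 = l" "table sg i (rmem s')" for s'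
      by (rule halts_Seq[OF update_table_halts[where sg = sg, OF s'], where ?T2.0 = 1])
        (simp_all add: halts_simps Inv_def pframe_def)
    ultimately show "bval (BNot (NLe (reg 0) (reg 4))) s \<and>
        halts (set_rreg 1 (RMul (RMem (reg 3)) bit_sign) ;; inc 3 ;; set_reg 5 (reg 1) ;; update_table ;; inc 4) s
          (d * 3 + 5) (Inv (Suc i))"
      using i inv by (simp add: halts_simps Inv_def pframe_def stored_upd_low table_def sg del: rval.simps(5))
  qed (simp add: Inv_def pframe_def)
  then show ?thesis
    by (rule halts_mono) (simp_all add: Inv_def rec_addr_Suc add_ac)
qed

lemma predictor_halts:
  assumes "trained n d m \<omega> s"
  shows "halts predictor (predict_state s x) (m * (n * (d * 3 + 6) + d * 3 + 13) + 5)
    (\<lambda>s'. rmem s' 0 = prediction n d \<omega> x m / m)"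
proof -
  define Inv where "Inv j s \<longleftrightarrow> pframe j s \<and> nmem s 3 = rec_addr n d j" for j and s :: state
  let ?kernel = "eval_kernel ;; set_rreg 0 (RAdd (rreg 0) (RMul (rreg 2) (RMem (NAdd (NConst 3) (reg 1))))) ;; inc 6"
  let ?label = "set_rreg 2 (RMem (reg 3)) ;; inc 3 ;; set_reg 4 (NConst 0) ;; ?kernel"
  let ?body = "set_reg 5 (NConst 0) ;; init_table ;; ?label"
  let ?loop = "While (BNot (NLe (reg 2) (reg 6))) ?body"
  have loop: "halts ?loop s (m * ((n * (d * 3 + 6) + d * 3 + 12) + 1) + 1) (Inv m)" if "Inv 0 s" for s
  proof (rule halts_While)
    fix j s assume j: "j < m" and inv: "Inv j s"
    define sg where "sg = (\<lambda>i. sgn_bit (fst (\<omega> j)) i * sgn_bit x i)"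
    have kernel: "halts ?kernel s (n * (d * 3 + 6) + 3) (Inv (Suc j))"
      if s: "pframe j s" "nmem s 3 = rec_addr n d j + 1" "nmem s 4 = 0" "rmem s 2 = snd (\<omega> j)" "table sg 0 (rmem s)" for s
    proof (rule halts_Seq[OF eval_kernel_halts[OF s(1) j s(2-4) sg_def s(5)], where ?T2.0 = 2])
      fix s' assume s': "pframe j s' \<and> nmem s' 3 = rec_addr n d (Suc j) \<and> rmem s' 2 = snd (\<omega> j) \<and> table sg n (rmem s')"
      then have "rmem s' (3 + d) = low_degree_sum sg n d" by (simp add: table_def)
      then show "halts (set_rreg 0 (RAdd (rreg 0) (RMul (rreg 2) (RMem (NAdd (NConst 3) (reg 1))))) ;; inc 6) s' 2 (Inv (Suc j))"
        using s' by (simp add: halts_simps Inv_def pframe_def stored_upd_low prediction_def sg_def)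
    qed simp
    have label: "halts ?label s (n * (d * 3 + 6) + 6) (Inv (Suc j))"
      if s: "pframe j s \<and> nmem s 3 = rec_addr n d j \<and> table sg 0 (rmem s)" for s
    proof -
      have "rmem s (rec_addr n d j) = snd (\<omega> j)"
        using s j by (simp add: pframe_def stored_def)
      then show ?thesis
        using s kernel by (simp add: halts_simps pframe_def stored_upd_low table_def add.commute)
    qed
    have "halts (init_table ;; ?label) s (n * (d * 3 + 6) + d * 3 + 11) (Inv (Suc j))"
      if "pframe j s" "nmem s 3 = rec_addr n d j" "nmem s 5 = 0" for s
      by (rule halts_Seq[OF init_table_halts[OF that] label]) simp_all
    then show "bval (BNot (NLe (reg 2) (reg 6))) s \<and>
        halts ?body s (n * (d * 3 + 6) + d * 3 + 12) (Inv (Suc j))"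
      using inv j by (simp add: halts_simps Inv_def pframe_def add.commute)
  qed (use that in \<open>simp_all add: Inv_def pframe_def\<close>)
  have "halts (?loop ;; set_rreg 0 (RDiv (rreg 0) (RNat (reg 2)))) s
      (m * (n * (d * 3 + 6) + d * 3 + 13) + 2) (\<lambda>s'. rmem s' 0 = prediction n d \<omega> x m / m)" if "Inv 0 s" for s
    by (rule halts_Seq[OF loop[OF that], where ?T2.0 = 1])
      (simp_all add: halts_simps Inv_def pframe_def)
  then show ?thesis
    unfolding predictor_def using assms
    by (simp add: halts_simps Inv_def pframe_def trained_def predict_state_def prediction_def stored_upd_low)
qed

end

section \<open>Correctness and running time\<close>

lemma halts_final:
  assumes "halts c s T Q"
  shows "Q (final c s)"
  using assms by (auto simp: halts_def final_eq)

text \<open>Exchanging the sums over examples and over sets turns the average of kernel values into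
  the combination with empirical coefficients.\<close>

lemma prediction_eq_empirical:
  "prediction n d \<omega> x m / m = (\<Sum>S\<in>low_degree n d. empirical m \<omega> S * walsh S x)"
proof -
  have "low_degree_sum (\<lambda>i. sgn_bit y i * sgn_bit x i) n d = (\<Sum>S\<in>low_degree n d. walsh S y * walsh S x)" for y
    by (simp add: low_degree_sum_eq walsh_def prod.distrib)
  then have "prediction n d \<omega> x m
      = (\<Sum>j<m. \<Sum>S\<in>low_degree n d. snd (\<omega> j) * (walsh S (fst (\<omega> j)) * walsh S x))"
    unfolding prediction_def by (simp add: sum_distrib_left)
  also have "\<dots> = (\<Sum>S\<in>low_degree n d. \<Sum>j<m. snd (\<omega> j) * walsh S (fst (\<omega> j)) * walsh S x)"
    by (subst sum.swap) (simp add: mult.assoc)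
  finally show ?thesis
    by (simp add: empirical_def sum_distrib_right sum_divide_distrib)
qed

definition xos_learner :: learner where
  "xos_learner = Learner trainer predictor"

lemma predictor_correct:
  assumes "halts trainer (train_state n \<epsilon> \<omega>) T (trained n d m \<omega>)" "x \<in> cube n"
  shows "hypothesis xos_learner n \<epsilon> \<omega> x = (\<Sum>S\<in>low_degree n d. empirical m \<omega> S * walsh S x)"
  using halts_final[OF predictor_halts[OF length_cube[OF assms(2)] halts_final[OF assms(1)]]]
  by (simp add: hypothesis_def xos_learner_def prediction_eq_empirical)

lemma xos_learner_learns: "agnostically_learns xos_learner xos_class"
  unfolding agnostically_learns_def
proof (intro allI impI ballI)
  fix n :: nat and \<epsilon> :: real and P
  assume \<epsilon>: "0 < \<epsilon>" and P: "P \<in> uniform_marginal_dists n"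
  interpret labelled_cube n P by standard (rule P)
  let ?P = "\<Pi>\<^sub>M i\<in>(UNIV :: nat set). P"
  interpret iid: prob_space ?P by (intro prob_space_PiM prob_space_axioms)
  have len: "length (fst (\<omega> j)) = n" if "\<omega> \<in> space ?P" for \<omega> j
  proof -
    have "\<omega> j \<in> space P" using that by (auto simp: space_PiM)
    then show ?thesis by (auto simp: space_P)
  qed
  show "2 / 3 \<le> measure ?P {\<omega> \<in> space ?P. l2_error P (hypothesis xos_learner n \<epsilon> \<omega>) \<le> opt P (xos_class n) + \<epsilon>}"
  proof (cases "1 \<le> \<epsilon>")
    case True
    \<comment> \<open>With no examples every empirical coefficient is 0, so the hypothesis vanishes
      on the cube.\<close>
    have "l2_error P (hypothesis xos_learner n \<epsilon> \<omega>) = l2_error P (\<lambda>x. 0)" for \<omega>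
      using predictor_correct[OF trainer_halts_large[OF True]]
      by (intro l2_error_cong) (simp add: empirical_def)
    then have "{\<omega> \<in> space ?P. l2_error P (hypothesis xos_learner n \<epsilon> \<omega>) \<le> opt P (xos_class n) + \<epsilon>} = space ?P"
      using l2_error_zero_le[OF True] by simp
    then show ?thesis by (simp add: iid.prob_space)
  next
    case False
    let ?h = "\<lambda>\<omega> x. \<Sum>S\<in>low_degree n (degree_for \<epsilon>). empirical (size_for n \<epsilon>) \<omega> S * walsh S x"
    have "l2_error P (hypothesis xos_learner n \<epsilon> \<omega>) = l2_error P (?h \<omega>)" if "\<omega> \<in> space ?P" for \<omega>
      using predictor_correct[OF trainer_halts_small[OF \<epsilon> _ len[OF that]]] False
      by (intro l2_error_cong) simp
    then have "{\<omega> \<in> space ?P. l2_error P (hypothesis xos_learner n \<epsilon> \<omega>) \<le> opt P (xos_class n) + \<epsilon>}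
        = {\<omega> \<in> space ?P. l2_error P (?h \<omega>) \<le> opt P (xos_class n) + \<epsilon>}"
      by auto
    then show ?thesis
      using empirical_low_degree_learns[OF degree_for(1)[OF \<epsilon>] \<epsilon>] size_for(1)[of n \<epsilon>]
      by (simp add: sample_bound_def)
  qed
qed

text \<open>With \<open>e = 1 / \<epsilon>\<close> the sample size supplies
  \<open>e\<^sup>2 * (real n + 1) ^ d\<close> and the degree one more factor \<open>e\<close>. The
  factors \<open>e ^ 3\<close>, \<open>(real n + 1) ^ d\<close> and \<open>real n + 1\<close> are at
  most \<open>N\<close> to the powers \<open>3 * e\<close>, \<open>4 * e\<close> and
  \<open>2 * e\<close>, which makes 9; the constant is \<open>21 * 24 * 3\<close>.\<close>

lemma work_bound:
  assumes "1 \<le> n" "0 < \<epsilon>" "\<epsilon> < 1"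
  shows "real (21 * (size_for n \<epsilon> * (n + 1) * (degree_for \<epsilon> + 1))) \<le> 1512 * real (max 2 n) powr (9 / \<epsilon>)"
proof -
  define e N d m where "e = 1 / \<epsilon>" and "N = real (max 2 n)" and "d = degree_for \<epsilon>" and "m = size_for n \<epsilon>"
  have e: "1 \<le> e" using assms by (simp add: e_def)
  have N: "2 \<le> N" by (simp add: N_def)
  \<comment> \<open>Minimality of the degree, used at \<open>d - 1\<close>, gives
    \<open>real d * \<epsilon> < 2\<close>.\<close>
  have d: "real d \<le> 2 * e"
  proof (cases d)
    case (Suc c)
    then have "real d * \<epsilon> < 2" using degree_for(2)[OF assms(2), of c] by (simp add: d_def add.commute)
    then show ?thesis using assms by (simp add: e_def field_simps)
  qed (use e in simp)
  have n: "real n + 1 \<le> N powr 2"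
  proof -
    have "real n \<le> N" by (simp add: N_def)
    moreover have "2 * N \<le> N * N" using N by (intro mult_right_mono) auto
    ultimately have "real n + 1 \<le> N * N" using N by linarith
    then show ?thesis using N by (simp add: powr_numeral power2_eq_square)
  qed
  have "e \<le> N powr e"
  proof -
    have "e \<le> 2 powr e"
    proof -
      \<comment> \<open>Rounding down reduces the claim to \<open>k + 1 \<le> 2 ^ k\<close>: the
        left side still exceeds \<open>e\<close>, and the right side is at most
        \<open>2 powr e\<close>.\<close>
      define k where "k = nat \<lfloor>e\<rfloor>"
      have k: "real k \<le> e" "e < real k + 1" using e by (simp_all add: k_def)
      have "Suc k \<le> 2 ^ k" by (simp add: Suc_le_eq)
      then have "real k + 1 \<le> 2 ^ k" by (metis of_nat_Suc of_nat_le_iff of_nat_numeral of_nat_power add.commute)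
      also have "\<dots> = 2 powr real k" by (simp add: powr_realpow)
      also have "\<dots> \<le> 2 powr e" using k by (intro powr_mono) auto
      finally show ?thesis using k by simp
    qed
    also have "\<dots> \<le> N powr e" using e N by (intro powr_mono2) auto
    finally show ?thesis .
  qed
  have pow: "(real n + 1) ^ d \<le> N powr (4 * e)"
  proof -
    have "(real n + 1) ^ d \<le> (N powr 2) ^ d" using n by (intro power_mono) auto
    also have "\<dots> = N powr (2 * real d)" using N by (subst powr_power) (auto simp: mult.commute)
    also have "\<dots> \<le> N powr (4 * e)" using N d by (intro powr_mono) auto
    finally show ?thesis .
  qed
  \<comment> \<open>Rounding up adds at most 1, which is at most the bound itself; this doubles the
    constant 12.\<close>
  have m: "real m \<le> 24 * e\<^sup>2 * (real n + 1) ^ d"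
  proof -
    have "1 \<le> 12 * e\<^sup>2 * (real n + 1) ^ d"
    proof -
      have "1 * 1 \<le> e\<^sup>2 * (real n + 1) ^ d" using e by (intro mult_mono one_le_power) auto
      then show ?thesis by simp
    qed
    moreover have "sample_bound n \<epsilon> = 12 * e\<^sup>2 * (real n + 1) ^ d"
      by (simp add: sample_bound_def e_def d_def power_divide)
    moreover have "real m \<le> sample_bound n \<epsilon> + 1"
      using size_for(2)[of "m - 1" n \<epsilon>] calculation by (cases m) (auto simp: m_def)
    ultimately show ?thesis by simp
  qed
  have "real m * (real n + 1) * (real d + 1) \<le> (24 * e\<^sup>2 * (real n + 1) ^ d) * (real n + 1) * (3 * e)"
    using m d e by (intro mult_mono) auto
  also have "\<dots> = 72 * (e ^ 3 * (real n + 1) ^ d * (real n + 1))"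
    by (simp add: power2_eq_square power3_eq_cube)
  also have "\<dots> \<le> 72 * ((N powr e) ^ 3 * N powr (4 * e) * N powr (2 * e))"
  proof -
    have "N powr 2 \<le> N powr (2 * e)" using N e by (intro powr_mono) auto
    then have "real n + 1 \<le> N powr (2 * e)" using n by linarith
    then show ?thesis
      using pow \<open>e \<le> N powr e\<close> e by (intro mult_left_mono mult_mono power_mono) auto
  qed
  also have "(N powr e) ^ 3 * N powr (4 * e) * N powr (2 * e) = N powr (9 * e)"
    using N by (simp add: powr_power flip: powr_add)
  finally have "real m * (real n + 1) * (real d + 1) \<le> 72 * N powr (9 * e)" .
  then show ?thesis by (simp add: m_def d_def N_def e_def algebra_simps)
qed

lemma xos_learner_time: "time_n_pow_O_inverse_eps xos_learner"
  unfolding time_n_pow_O_inverse_eps_def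
proof (intro exI allI impI)
  fix n :: nat and \<epsilon> :: real
  assume n: "1 \<le> n" and \<epsilon>: "0 < \<epsilon>"
  let ?T = "1512 * real (max 2 n) powr (9 / \<epsilon>)"
  show "runs_in_time xos_learner n \<epsilon> ?T"
    unfolding runs_in_time_def
  proof (intro allI impI)
    fix \<omega> :: "nat \<Rightarrow> bool list \<times> real"
    assume "\<forall>i. \<omega> i \<in> space (example_space n)"
    then have "fst (\<omega> i) \<in> cube n" for i
      by (metis SigmaE example_space_def fst_conv space_count_space space_pair_measure)
    then have len: "length (fst (\<omega> i)) = n" for i by simp
    have "\<exists>d m T. halts trainer (train_state n \<epsilon> \<omega>) T (trained n d m \<omega>) \<and> real T \<le> ?T \<and>
        real (m * (n * (d * 3 + 6) + d * 3 + 13) + 5) \<le> ?T"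
    proof (cases "1 \<le> \<epsilon>")
      case True
      \<comment> \<open>The power is at least 1, so the constant factor alone covers the 2 steps of
        training and the 5 of prediction from an empty sample.\<close>
      have "1 \<le> real (max 2 n) powr (9 / \<epsilon>)" using \<epsilon> by (intro ge_one_powr_ge_zero) auto
      then show ?thesis
        using trainer_halts_large[OF True, of n \<omega>]
        by (intro exI[of _ 0] exI[of _ 2]) auto
    next
      case False
      let ?d = "degree_for \<epsilon>" and ?m = "size_for n \<epsilon>"
      have "0 < sample_bound n \<epsilon>" using \<epsilon> by (simp add: sample_bound_def)
      \<comment> \<open>A nonempty sample lets the product of \<open>?m\<close>,
        \<open>n + 1\<close> and \<open>?d + 1\<close> absorb the additive terms of both time
        bounds.\<close>
      then have "1 \<le> ?m" using size_for(1)[of n \<epsilon>] by (cases ?m) auto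
      then have "1 \<le> ?m * (n + 1)" by simp
      then have "1 * (?d + 1) \<le> ?m * (n + 1) * (?d + 1)" by (rule mult_le_mono1)
      then have w: "?d + 1 \<le> ?m * (n + 1) * (?d + 1)" by simp
      have p: "n * (?d * 3 + 6) + ?d * 3 + 13 \<le> 13 * ((n + 1) * (?d + 1))"
        and t: "4 * n + 7 \<le> 7 * ((n + 1) * (?d + 1))"
        by (simp_all add: algebra_simps)
      have "?m * (n * (?d * 3 + 6) + ?d * 3 + 13) \<le> 13 * (?m * (n + 1) * (?d + 1))"
        using mult_le_mono2[OF p, of ?m] by (simp only: ac_simps)
      moreover have "?m * (4 * n + 7) \<le> 7 * (?m * (n + 1) * (?d + 1))"
        using mult_le_mono2[OF t, of ?m] by (simp only: ac_simps)
      ultimately have "?m * (n * (?d * 3 + 6) + ?d * 3 + 13) + 5 \<le> 21 * (?m * (n + 1) * (?d + 1))"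
        "?m * (4 * n + 7) + ?d * 3 + 5 \<le> 21 * (?m * (n + 1) * (?d + 1))"
        using w by linarith+
      then have "real (?m * (n * (?d * 3 + 6) + ?d * 3 + 13) + 5) \<le> ?T"
        "real (?m * (4 * n + 7) + ?d * 3 + 5) \<le> ?T"
        using False by (intro order_trans[OF of_nat_mono work_bound[OF n \<epsilon>]]; simp)+
      moreover have "halts trainer (train_state n \<epsilon> \<omega>) (?m * (4 * n + 7) + ?d * 3 + 5) (trained n ?d ?m \<omega>)"
        using False by (intro trainer_halts_small[OF \<epsilon> _ len]) simp
      ultimately show ?thesis by blast
    qed
    then obtain d m T where T: "halts trainer (train_state n \<epsilon> \<omega>) T (trained n d m \<omega>)" "real T \<le> ?T"
      "real (m * (n * (d * 3 + 6) + d * 3 + 13) + 5) \<le> ?T" by blast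
    from T(1) obtain t s where s: "exec trainer (train_state n \<epsilon> \<omega>) t s" "t \<le> T" "trained n d m \<omega> s"
      by (auto simp: halts_def)
    have "\<exists>t' s'. exec predictor (predict_state s x) t' s' \<and> real t' \<le> ?T" if x: "x \<in> cube n" for x
    proof -
      obtain t' s' where "exec predictor (predict_state s x) t' s'"
        "t' \<le> m * (n * (d * 3 + 6) + d * 3 + 13) + 5"
        using predictor_halts[OF length_cube[OF x] s(3)] unfolding halts_def by blast
      then show ?thesis using T(3) order_trans[OF of_nat_mono] by blast
    qed
    moreover have "real t \<le> ?T" using s(2) T(2) by linarith
    ultimately show "\<exists>t s. exec (train xos_learner) (train_state n \<epsilon> \<omega>) t s \<and> real t \<le> ?T \<and>
        (\<forall>x\<in>cube n. \<exists>t' s'. exec (predict xos_learner) (predict_state s x) t' s' \<and> real t' \<le> ?T)"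
      using s(1) by (intro exI[of _ t] exI[of _ s]) (simp add: xos_learner_def)
  qed
qed

theorem theorem5p13:
  "\<exists>A. agnostically_learns A xos_class \<and> time_n_pow_O_inverse_eps A"
  using xos_learner_learns xos_learner_time by blast

end
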